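(* Let $\mathbb{F}$ be an algebraically closed field with $\mathrm{Char}(\mathbb{F})\neq 2$ and let $d\ge 3$. Let $A,A^*$ be a Leonard pair over $\mathbb{F}$ with diameter $d$ that has dual $q$-Krawtchouk type, and let $F$ denote the flat part of $A$. Let $(\{\theta_i\}_{i=0}^d;\{\theta^*_i\}_{i=0}^d;\{\varphi_i\}_{i=1}^d;\{\phi_i\}_{i=1}^d)$ be a parameter array of $A,A^*$ with corresponding primary $q$-data $(\delta,\mu,h,\delta^*,\mu^*,h^*,\tau)$. Choose scalars $\mu',h'\in\mathbb{F}$ with $\mu'+h'=0$ and $\mu'h'=\mu h$, and define $\{\theta'_i\}_{i=0}^d,\{\varphi'_i\}_{i=1}^d,\{\phi'_i\}_{i=1}^d$ by $\theta'_i=\mu'q^{2i-d}+h'q^{d-2i}$ and: if $\mu^*=0$, $$\varphi'_i=\mu'h^*q^{d-2i+1}(q^i-q^{-i})(q^{d-i+1}-q^{i-d-1}),\qquad \phi'_i=h'h^*q^{d-2i+1}(q^i-q^{-i})(q^{d-i+1}-q^{i-d-1});$$ if $h^*=0$, $$\varphi'_i=h'\mu^*q^{2i-d-1}(q^i-q^{-i})(q^{d-i+1}-q^{i-d-1}),\qquad \phi'_i=\mu'\mu^*q^{2i-d-1}(q^i-q^{-i})(q^{d-i+1}-q^{i-d-1}).$$ Then the following are equivalent: (i) the Leonard pair $A,A^*$ is near-bipartite; (ii) $A-F$ is diagonalizable; (iii) $A-F$ is multiplicity-free; (iv) $q^{2i}\neq -1$ for $1\le i\le d-1$. Suppose (i)--(iv)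 hold. Then the bipartite contraction of $A,A^*$ has parameter array $(\{\theta'_i\}_{i=0}^d;\{\theta^*_i\}_{i=0}^d;\{\varphi'_i\}_{i=1}^d;\{\phi'_i\}_{i=1}^d)$.
   Context: A tridiagonal matrix is irreducible if all its subdiagonal and superdiagonal entries are nonzero. Let $V$ be a vector space over $\mathbb{F}$ of dimension $d+1$. A Leonard pair on $V$ (with diameter $d$, over $\mathbb{F}$) is an ordered pair $A,A^*$ in $\mathrm{End}(V)$ such that (a) some basis of $V$ makes the matrix of $A$ irreducible tridiagonal and that of $A^*$ diagonal; (b) some basis of $V$ makes the matrix of $A^*$ irreducible tridiagonal and that of $A$ diagonal. ($A^*$ is just a name, not an adjoint.) Each of $A,A^*$ then has $d+1$ distinct eigenvalues. An element of $\mathrm{End}(V)$ is multiplicity-free if it is diagonalizable with all eigenspaces of dimension one. Flat part: let $E^*_0,\dots,E^*_d$ be the primitive idempotents of $A^*$ (projections onto its eigenspaces along the sum of the other eigenspaces). The flat part of $A$ is $F=\sum_{i=0}^d E^*_i A E^*_i$. $A,A^*$ is near-bipartite if $A-F,A^*$ is a Leonard pair on $V$; in that case $A-F,A^*$ is called the bipartite contraction of $A,A^*$. Parameter array: an ordering $\{\theta_i\}_{i=0}^d$ of the eigenvalues of $A$ is standard if in some basis $A$ is $\mathrm{diag}(\theta_0,\dots,\theta_d)$ and $A^*$ is irreducible tridiagonal; a standard ordering $\{\theta^*_i\}_{i=0}^d$ of the eigenvalues of $A^*$ is defined with the roles of $A$ and $A^*$ exchanged. Given standard orderings, there are unique scalars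 $\{\varphi_i\}_{i=1}^d$ such that in some basis $A$ is lower bidiagonal with diagonal $\theta_0,\dots,\theta_d$ and all subdiagonal entries $1$, while $A^*$ is upper bidiagonal with diagonal $\theta^*_0,\dots,\theta^*_d$ and superdiagonal $\varphi_1,\dots,\varphi_d$; and unique scalars $\{\phi_i\}_{i=1}^d$ such that in some basis $A$ is lower bidiagonal with diagonal $\theta_d,\theta_{d-1},\dots,\theta_0$ and all subdiagonal entries $1$, while $A^*$ is upper bidiagonal with diagonal $\theta^*_0,\dots,\theta^*_d$ and superdiagonal $\phi_1,\dots,\phi_d$. The sequence $(\{\theta_i\};\{\theta^*_i\};\{\varphi_i\};\{\phi_i\})$ is a parameter array of $A,A^*$. Type I: for $d\ge 3$ it is known that $\frac{\theta_{i-2}-\theta_{i+1}}{\theta_{i-1}-\theta_i}$ and $\frac{\theta^*_{i-2}-\theta^*_{i+1}}{\theta^*_{i-1}-\theta^*_i}$ are equal and independent of $i$ for $2\le i\le d-1$; their common value is written $\beta+1$, and $\beta$ is the fundamental constant. $A,A^*$ has type I if $\beta\neq\pm2$; then fix nonzero $q\in\mathbb{F}$ with $\beta=q^2+q^{-2}$ (so $q^4\ne1$). It is known that a parameter array of type I has the form $\theta_i=\delta+\mu q^{2i-d}+hq^{d-2i}$, $\theta^*_i=\delta^*+\mu^*q^{2i-d}+h^*q^{d-2i}$ $(0\le i\le d)$, $\varphi_i=(q^i-q^{-i})(q^{d-i+1}-q^{i-d-1})(\tau-\mu\mu^*q^{2i-d-1}-hh^*q^{d-2i+1})$, $\phi_i=(q^i-q^{-i})(q^{d-i+1}-q^{i-d-1})(\tau-h\mu^*q^{2i-d-1}-\mu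 h^*q^{d-2i+1})$ $(1\le i\le d)$ for a unique sequence $(\delta,\mu,h,\delta^*,\mu^*,h^*,\tau)$ of scalars in $\mathbb{F}$, called the corresponding primary $q$-data. $A,A^*$ has dual $q$-Krawtchouk type if it has type I, $(\theta^*_{i-1}-\theta^*_i)/(\theta^*_i-\theta^*_{i+1})$ is independent of $i$ for $1\le i\le d-1$, and $\varphi_i/\phi_i$ is independent of $i$ for $1\le i\le d$. In that case exactly one of $\mu^*,h^*$ is zero, and $\tau=0$. *)

theory Defs
  imports "HOL-Computational_Algebra.Computational_Algebra"
begin

text \<open>
  Square matrices of size \<open>d + 1\<close> are functions \<open>nat \<Rightarrow> nat \<Rightarrow> 'a\<close> (row, column), of which only the
  entries with both indices \<open>\<le> d\<close> matter. Sequences indexed by \<open>0..d\<close> or \<open>1..d\<close> are functions on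
  \<open>nat\<close>, of which only the values in that range matter.
\<close>

definition diagonal_upto :: "nat \<Rightarrow> (nat \<Rightarrow> nat \<Rightarrow> 'a::field) \<Rightarrow> bool" where
  "diagonal_upto d M \<longleftrightarrow> (\<forall>i\<le>d. \<forall>j\<le>d. i \<noteq> j \<longrightarrow> M i j = 0)"

definition diagonal_with :: "nat \<Rightarrow> (nat \<Rightarrow> 'a::field) \<Rightarrow> (nat \<Rightarrow> nat \<Rightarrow> 'a) \<Rightarrow> bool" where
  "diagonal_with d \<theta> M \<longleftrightarrow> (\<forall>i\<le>d. \<forall>j\<le>d. M i j = (if i = j then \<theta> i else 0))"

definition irreducible_tridiagonal :: "nat \<Rightarrow> (nat \<Rightarrow> nat \<Rightarrow> 'a::field) \<Rightarrow> bool" where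
  "irreducible_tridiagonal d M \<longleftrightarrow>
     (\<forall>i\<le>d. \<forall>j\<le>d. (i > Suc j \<or> j > Suc i \<longrightarrow> M i j = 0)
                     \<and> (i = Suc j \<or> j = Suc i \<longrightarrow> M i j \<noteq> 0))"

definition lower_bidiagonal :: "nat \<Rightarrow> (nat \<Rightarrow> 'a::field) \<Rightarrow> (nat \<Rightarrow> nat \<Rightarrow> 'a) \<Rightarrow> bool" where
  "lower_bidiagonal d \<theta> M \<longleftrightarrow>
     (\<forall>i\<le>d. \<forall>j\<le>d. M i j = (if i = j then \<theta> i else if i = Suc j then 1 else 0))"

definition upper_bidiagonal ::
  "nat \<Rightarrow> (nat \<Rightarrow> 'a::field) \<Rightarrow> (nat \<Rightarrow> 'a) \<Rightarrow> (nat \<Rightarrow> nat \<Rightarrow> 'a) \<Rightarrow> bool" where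
  "upper_bidiagonal d \<theta> \<phi> M \<longleftrightarrow>
     (\<forall>i\<le>d. \<forall>j\<le>d. M i j = (if i = j then \<theta> i else if j = Suc i then \<phi> j else 0))"

text \<open>
  The vector space is a type \<open>'b\<close> with an explicit scalar multiplication \<open>s\<close> satisfying
  \<^locale>\<open>vector_space\<close>.
\<close>

type_synonym ('a, 'b) scalar_mult = "'a \<Rightarrow> 'b \<Rightarrow> 'b"

definition indexed_basis :: "('a::field, 'b::ab_group_add) scalar_mult \<Rightarrow> nat \<Rightarrow> (nat \<Rightarrow> 'b) \<Rightarrow> bool" where
  "indexed_basis s d v \<longleftrightarrow>
     inj_on v {..d} \<and> \<not> module.dependent s (v ` {..d}) \<and> module.span s (v ` {..d}) = UNIV"

text \<open>Column convention: \<open>A (v j) = (\<Sum>i\<le>d. s (matrix_of s d v A i j) (v i))\<close>.\<close>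

definition matrix_of ::
  "('a::field, 'b::ab_group_add) scalar_mult \<Rightarrow> nat \<Rightarrow> (nat \<Rightarrow> 'b) \<Rightarrow> ('b \<Rightarrow> 'b) \<Rightarrow> nat \<Rightarrow> nat \<Rightarrow> 'a" where
  "matrix_of s d v A i j = module.representation s (v ` {..d}) (A (v j)) (v i)"

definition leonard_pair ::
  "('a::field, 'b::ab_group_add) scalar_mult \<Rightarrow> nat \<Rightarrow> ('b \<Rightarrow> 'b) \<Rightarrow> ('b \<Rightarrow> 'b) \<Rightarrow> bool" where
  "leonard_pair s d A As \<longleftrightarrow>
     vector_space.dim s UNIV = d + 1 \<and>
     Vector_Spaces.linear s s A \<and> Vector_Spaces.linear s s As \<and>
     (\<exists>v. indexed_basis s d v \<and> irreducible_tridiagonal d (matrix_of s d v A)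
          \<and> diagonal_upto d (matrix_of s d v As)) \<and>
     (\<exists>v. indexed_basis s d v \<and> irreducible_tridiagonal d (matrix_of s d v As)
          \<and> diagonal_upto d (matrix_of s d v A))"

definition eigenspace :: "('a::field, 'b::ab_group_add) scalar_mult \<Rightarrow> ('b \<Rightarrow> 'b) \<Rightarrow> 'a \<Rightarrow> 'b set" where
  "eigenspace s A t = {v. A v = s t v}"

definition eigenvalues :: "('a::field, 'b::ab_group_add) scalar_mult \<Rightarrow> ('b \<Rightarrow> 'b) \<Rightarrow> 'a set" where
  "eigenvalues s A = {t. \<exists>v. v \<noteq> 0 \<and> A v = s t v}"

definition diagonalizable :: "('a::field, 'b::ab_group_add) scalar_mult \<Rightarrow> ('b \<Rightarrow> 'b) \<Rightarrow> bool" where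
  "diagonalizable s A \<longleftrightarrow>
     (\<exists>B. \<not> module.dependent s B \<and> module.span s B = UNIV \<and> (\<forall>v\<in>B. \<exists>t. A v = s t v))"

definition multiplicity_free :: "('a::field, 'b::ab_group_add) scalar_mult \<Rightarrow> ('b \<Rightarrow> 'b) \<Rightarrow> bool" where
  "multiplicity_free s A \<longleftrightarrow>
     diagonalizable s A \<and> (\<forall>t\<in>eigenvalues s A. vector_space.dim s (eigenspace s A t) = 1)"

text \<open>
  The projection onto an eigenspace along the sum of the other eigenspaces; it is well defined
  when \<open>A\<close> is diagonalizable.
\<close>

definition primitive_idempotent ::
  "('a::field, 'b::ab_group_add) scalar_mult \<Rightarrow> ('b \<Rightarrow> 'b) \<Rightarrow> 'a \<Rightarrow> 'b \<Rightarrow> 'b" where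
  "primitive_idempotent s A t =
     (THE E. Vector_Spaces.linear s s E \<and> (\<forall>v\<in>eigenspace s A t. E v = v)
             \<and> (\<forall>u\<in>eigenvalues s A - {t}. \<forall>v\<in>eigenspace s A u. E v = 0))"

definition flat_part ::
  "('a::field, 'b::ab_group_add) scalar_mult \<Rightarrow> ('b \<Rightarrow> 'b) \<Rightarrow> ('b \<Rightarrow> 'b) \<Rightarrow> 'b \<Rightarrow> 'b" where
  "flat_part s A As v =
     (\<Sum>t\<in>eigenvalues s As. primitive_idempotent s As t (A (primitive_idempotent s As t v)))"

definition near_bipartite ::
  "('a::field, 'b::ab_group_add) scalar_mult \<Rightarrow> nat \<Rightarrow> ('b \<Rightarrow> 'b) \<Rightarrow> ('b \<Rightarrow> 'b) \<Rightarrow> bool" where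
  "near_bipartite s d A As \<longleftrightarrow> leonard_pair s d A As \<and> leonard_pair s d (A - flat_part s A As) As"

text \<open>
  A standard ordering of the eigenvalues of the first argument. With the arguments
  exchanged this gives the standard orderings of the eigenvalues of the second one.
\<close>

definition standard_ordering ::
  "('a::field, 'b::ab_group_add) scalar_mult \<Rightarrow> nat \<Rightarrow> ('b \<Rightarrow> 'b) \<Rightarrow> ('b \<Rightarrow> 'b) \<Rightarrow> (nat \<Rightarrow> 'a) \<Rightarrow> bool" where
  "standard_ordering s d A As \<theta> \<longleftrightarrow>
     bij_betw \<theta> {..d} (eigenvalues s A) \<and>
     (\<exists>v. indexed_basis s d v \<and> diagonal_with d \<theta> (matrix_of s d v A)
          \<and> irreducible_tridiagonal d (matrix_of s d v As))"

definition parameter_array ::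
  "('a::field, 'b::ab_group_add) scalar_mult \<Rightarrow> nat \<Rightarrow> ('b \<Rightarrow> 'b) \<Rightarrow> ('b \<Rightarrow> 'b) \<Rightarrow>
   (nat \<Rightarrow> 'a) \<Rightarrow> (nat \<Rightarrow> 'a) \<Rightarrow> (nat \<Rightarrow> 'a) \<Rightarrow> (nat \<Rightarrow> 'a) \<Rightarrow> bool"
where
  "parameter_array s d A As \<theta> \<theta>s \<phi>1 \<phi>2 \<longleftrightarrow>
     leonard_pair s d A As \<and> standard_ordering s d A As \<theta> \<and> standard_ordering s d As A \<theta>s \<and>
     (\<exists>v. indexed_basis s d v \<and> lower_bidiagonal d \<theta> (matrix_of s d v A)
          \<and> upper_bidiagonal d \<theta>s \<phi>1 (matrix_of s d v As)) \<and>
     (\<exists>v. indexed_basis s d v \<and> lower_bidiagonal d (\<lambda>i. \<theta> (d - i)) (matrix_of s d v A)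
          \<and> upper_bidiagonal d \<theta>s \<phi>2 (matrix_of s d v As))"

text \<open>
  The next three notions concern the pair and not a chosen parameter array: by the standard theory
  a Leonard pair has parameter arrays, and the conditions below hold for one of them
  (one pair of standard orderings) if and only if they hold for all.
\<close>

definition fundamental_constant ::
  "('a::field, 'b::ab_group_add) scalar_mult \<Rightarrow> nat \<Rightarrow> ('b \<Rightarrow> 'b) \<Rightarrow> ('b \<Rightarrow> 'b) \<Rightarrow> 'a \<Rightarrow> bool" where
  "fundamental_constant s d A As \<beta> \<longleftrightarrow>
     3 \<le> d \<and> leonard_pair s d A As \<and>
     (\<forall>\<theta> \<theta>s. standard_ordering s d A As \<theta> \<and> standard_ordering s d As A \<theta>s \<longrightarrow>
        (\<forall>i\<in>{2..d-1}.
           (\<theta> (i - 2) - \<theta> (i + 1)) / (\<theta> (i - 1) - \<theta> i) = \<beta> + 1 \<and>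
           (\<theta>s (i - 2) - \<theta>s (i + 1)) / (\<theta>s (i - 1) - \<theta>s i) = \<beta> + 1))"

definition type_I :: "('a::field, 'b::ab_group_add) scalar_mult \<Rightarrow> nat \<Rightarrow> ('b \<Rightarrow> 'b) \<Rightarrow> ('b \<Rightarrow> 'b) \<Rightarrow> bool" where
  "type_I s d A As \<longleftrightarrow> (\<exists>\<beta>. fundamental_constant s d A As \<beta> \<and> \<beta> \<noteq> 2 \<and> \<beta> \<noteq> -2)"

definition dual_q_Krawtchouk_type ::
  "('a::field, 'b::ab_group_add) scalar_mult \<Rightarrow> nat \<Rightarrow> ('b \<Rightarrow> 'b) \<Rightarrow> ('b \<Rightarrow> 'b) \<Rightarrow> bool" where
  "dual_q_Krawtchouk_type s d A As \<longleftrightarrow>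
     type_I s d A As \<and>
     (\<forall>\<theta> \<theta>s \<phi>1 \<phi>2. parameter_array s d A As \<theta> \<theta>s \<phi>1 \<phi>2 \<longrightarrow>
        (\<exists>c. \<forall>i\<in>{1..d-1}. (\<theta>s (i - 1) - \<theta>s i) / (\<theta>s i - \<theta>s (i + 1)) = c) \<and>
        (\<exists>c. \<forall>i\<in>{1..d}. \<phi>1 i / \<phi>2 i = c))"

text \<open>The factor shared by both split sequences.\<close>

definition split_factor :: "nat \<Rightarrow> 'a::field \<Rightarrow> nat \<Rightarrow> 'a" where
  "split_factor d q i =
     (q powi int i - q powi (- int i)) *
     (q powi (int d - int i + 1) - q powi (int i - int d - 1))"

definition primary_q_data ::
  "nat \<Rightarrow> 'a::field \<Rightarrow> (nat \<Rightarrow> 'a) \<Rightarrow> (nat \<Rightarrow> 'a) \<Rightarrow> (nat \<Rightarrow> 'a) \<Rightarrow> (nat \<Rightarrow> 'a) \<Rightarrow>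
   'a \<Rightarrow> 'a \<Rightarrow> 'a \<Rightarrow> 'a \<Rightarrow> 'a \<Rightarrow> 'a \<Rightarrow> 'a \<Rightarrow> bool"
where
  "primary_q_data d q \<theta> \<theta>s \<phi>1 \<phi>2 \<delta> \<mu> h \<delta>s \<mu>s hs \<tau> \<longleftrightarrow>
     (\<forall>i\<le>d. \<theta> i = \<delta> + \<mu> * q powi (2 * int i - int d) + h * q powi (int d - 2 * int i)) \<and>
     (\<forall>i\<le>d. \<theta>s i = \<delta>s + \<mu>s * q powi (2 * int i - int d) + hs * q powi (int d - 2 * int i)) \<and>
     (\<forall>i\<in>{1..d}. \<phi>1 i = split_factor d q i *
        (\<tau> - \<mu> * \<mu>s * q powi (2 * int i - int d - 1) - h * hs * q powi (int d - 2 * int i + 1))) \<and>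
     (\<forall>i\<in>{1..d}. \<phi>2 i = split_factor d q i *
        (\<tau> - h * \<mu>s * q powi (2 * int i - int d - 1) - \<mu> * hs * q powi (int d - 2 * int i + 1)))"

end

theory Submission
  imports Defs
begin

text \<open>
  Since \<open>\<mu>s * hs = 0\<close> and inverting \<open>q\<close> exchanges the two cases, take \<open>hs = 0\<close> and put \<open>r = q\<^sup>2\<close>.
  All data become Laurent polynomials in \<open>r ^ i\<close>: \<open>\<theta> i = \<delta> + a r ^ i + b / r ^ i\<close> and
  \<open>\<theta>s i = \<delta>s + m r ^ i\<close>. Explicit unitriangular matrices pass between a split basis and an eigenbasis
  of \<open>As\<close>, in which \<open>A\<close> is tridiagonal with subdiagonal \<open>1\<close>, diagonal \<open>\<delta> + (a r ^ d + b) / r ^ i\<close> and a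
  superdiagonal that depends on \<open>a\<close> and \<open>b\<close> only through \<open>a * b\<close>. Removing the flat part erases the diagonal,
  so \<open>A - F\<close> has the same shape with \<open>\<delta> = 0\<close> and \<open>(a, b)\<close> replaced by \<open>(a', b')\<close>, where \<open>a' b' = a b\<close> and
  \<open>a' r ^ d + b' = 0\<close>; passing back to split bases for \<open>(a', b')\<close> and for its mirror image
  \<open>(b' / r ^ d, a' r ^ d)\<close> gives both split forms of \<open>A - F\<close>, whether or not it is diagonalizable.
  A lower bidiagonal matrix with subdiagonal \<open>1\<close> is diagonalizable only if its diagonal entries are
  distinct, which here means \<open>r ^ k \<noteq> -1\<close> for \<open>1 \<le> k < d\<close>, and then the two split forms make \<open>As\<close> irreducible
  tridiagonal in an eigenbasis of \<open>A - F\<close>.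
\<close>

section \<open>Matrices of operators\<close>

text \<open>Each off-diagonal sequence is indexed by the larger of row and column, hence by 1..d as
  the split sequences are. Diagonal, bidiagonal and tridiagonal matrices are all instances, so two
  summation rules serve every matrix product below.\<close>

definition tri_matrix :: "(nat \<Rightarrow> 'a) \<Rightarrow> (nat \<Rightarrow> 'a) \<Rightarrow> (nat \<Rightarrow> 'a) \<Rightarrow> nat \<Rightarrow> nat \<Rightarrow> 'a::field" where
  "tri_matrix l a u i j = (if i = j then a i else if i = Suc j then l i else if j = Suc i then u j else 0)"

lemma sum_tri_matrix_row:
  assumes "i \<le> d"
  shows "(\<Sum>k\<le>d. tri_matrix l a u i k * c k) =
    a i * c i + (if 0 < i then l i * c (i - 1) else 0) + (if i < d then u (Suc i) * c (Suc i) else 0)"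
proof -
  \<comment> \<open>For \<open>i = 0\<close> truncated subtraction makes \<open>i - 1\<close>
    coincide with \<open>i\<close>; the guard \<open>0 < i\<close> keeps a spurious summand off the
    diagonal term.\<close>
  have "(\<Sum>k\<le>d. tri_matrix l a u i k * c k) =
     (\<Sum>k\<le>d. (if k = i then a i * c i else 0) + (if k = i - 1 then (if 0 < i then l i * c (i - 1) else 0) else 0)
       + (if k = Suc i then u (Suc i) * c (Suc i) else 0))"
    by (rule sum.cong) (auto simp: tri_matrix_def)
  then show ?thesis
    using assms by (auto simp: sum.distrib)
qed

lemma sum_tri_matrix_col:
  assumes "j \<le> d"
  shows "(\<Sum>k\<le>d. c k * tri_matrix l a u k j) =
    c j * a j + (if j < d then c (Suc j) * l (Suc j) else 0) + (if 0 < j then c (j - 1) * u j else 0)"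
proof -
  have "(\<Sum>k\<le>d. c k * tri_matrix l a u k j) =
     (\<Sum>k\<le>d. (if k = j then c j * a j else 0) + (if k = Suc j then c (Suc j) * l (Suc j) else 0)
       + (if k = j - 1 then (if 0 < j then c (j - 1) * u j else 0) else 0))"
    by (rule sum.cong) (auto simp: tri_matrix_def)
  then show ?thesis
    using assms by (auto simp: sum.distrib)
qed

section \<open>Coordinates and matrices with respect to an indexed basis\<close>

locale scalar_space = vector_space scale
  for scale :: "'a::field \<Rightarrow> 'b::ab_group_add \<Rightarrow> 'b" (infixr "*s" 75)
begin

text \<open>A relation, so that a matrix can be given by a formula on all of \<open>nat\<close> and
  the family \<open>v\<close> may still await its proof of being a basis. For a basis it amounts to
  agreement with \<open>matrix_of\<close>, by \<open>has_matrix_iff\<close>.\<close>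

definition has_matrix :: "nat \<Rightarrow> (nat \<Rightarrow> 'b) \<Rightarrow> ('b \<Rightarrow> 'b) \<Rightarrow> (nat \<Rightarrow> nat \<Rightarrow> 'a) \<Rightarrow> bool" where
  "has_matrix d v A M \<longleftrightarrow> (\<forall>j\<le>d. A (v j) = (\<Sum>i\<le>d. M i j *s v i))"

lemma indexed_basisD:
  assumes "indexed_basis scale d v"
  shows "inj_on v {..d}" "independent (v ` {..d})" "span (v ` {..d}) = UNIV"
  using assms by (auto simp: indexed_basis_def)

lemma representation_indexed_basis:
  assumes "indexed_basis scale d v" "i \<le> d"
  shows "representation (v ` {..d}) (\<Sum>j\<le>d. c j *s v j) (v i) = c i"
proof -
  note b = indexed_basisD[OF assms(1)]
  have "representation (v ` {..d}) (\<Sum>j\<le>d. c j *s v j) (v i)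
    = (\<Sum>j\<le>d. representation (v ` {..d}) (c j *s v j) (v i))"
    by (subst representation_sum) (use b in auto)
  also have "\<dots> = (\<Sum>j\<le>d. if j = i then c i else 0)"
    using assms(2) b by (intro sum.cong) (auto simp: representation_scale representation_basis inj_on_eq_iff)
  finally show ?thesis using assms(2) by simp
qed

lemma indexed_basis_expand:
  assumes "indexed_basis scale d v"
  shows "x = (\<Sum>j\<le>d. representation (v ` {..d}) x (v j) *s v j)"
proof -
  note b = indexed_basisD[OF assms]
  have "(\<Sum>y\<in>v ` {..d}. representation (v ` {..d}) x y *s y) = x"
    by (rule sum_representation_eq) (use b in auto)
  then show ?thesis
    using b(1) by (simp add: sum.reindex)
qed

lemma indexed_basis_coeff_eq:
  assumes "indexed_basis scale d v" "(\<Sum>j\<le>d. c j *s v j) = (\<Sum>j\<le>d. e j *s v j)" "i \<le> d"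
  shows "c i = e i"
  using representation_indexed_basis[OF assms(1,3)] assms(2) by metis

lemma matrix_of_eqI:
  assumes "indexed_basis scale d v" "has_matrix d v A M" "i \<le> d" "j \<le> d"
  shows "matrix_of scale d v A i j = M i j"
  using assms representation_indexed_basis[OF assms(1,3), of "\<lambda>i. M i j"]
  by (simp add: matrix_of_def has_matrix_def)

lemma has_matrix_matrix_of:
  assumes "indexed_basis scale d v"
  shows "has_matrix d v A (matrix_of scale d v A)"
  using indexed_basis_expand[OF assms] by (simp add: matrix_of_def has_matrix_def)

lemma has_matrix_cong:
  assumes "\<And>i j. i \<le> d \<Longrightarrow> j \<le> d \<Longrightarrow> M i j = N i j"
  shows "has_matrix d v A M \<longleftrightarrow> has_matrix d v A N"
  using assms by (auto simp: has_matrix_def)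

lemma has_matrix_iff:
  assumes "indexed_basis scale d v"
  shows "has_matrix d v A M \<longleftrightarrow> (\<forall>i\<le>d. \<forall>j\<le>d. matrix_of scale d v A i j = M i j)"
  using matrix_of_eqI[OF assms] has_matrix_matrix_of[OF assms, of A] has_matrix_cong[of d "matrix_of scale d v A" M v A]
  by blast

lemma lower_bidiagonal_iff_has_matrix:
  assumes "indexed_basis scale d v"
  shows "lower_bidiagonal d \<theta> (matrix_of scale d v A) \<longleftrightarrow> has_matrix d v A (tri_matrix (\<lambda>_. 1) \<theta> (\<lambda>_. 0))"
  unfolding has_matrix_iff[OF assms] lower_bidiagonal_def tri_matrix_def by simp

lemma upper_bidiagonal_iff_has_matrix:
  assumes "indexed_basis scale d v"
  shows "upper_bidiagonal d \<theta> \<phi> (matrix_of scale d v A) \<longleftrightarrow> has_matrix d v A (tri_matrix (\<lambda>_. 0) \<theta> \<phi>)"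
proof -
  have "tri_matrix (\<lambda>_. 0) \<theta> \<phi> i j = (if i = j then \<theta> i else if j = Suc i then \<phi> j else 0)" for i j
    by (simp add: tri_matrix_def)
  then show ?thesis by (simp add: has_matrix_iff[OF assms] upper_bidiagonal_def)
qed

lemma diagonal_with_iff_has_matrix:
  assumes "indexed_basis scale d v"
  shows "diagonal_with d \<theta> (matrix_of scale d v A) \<longleftrightarrow> has_matrix d v A (tri_matrix (\<lambda>_. 0) \<theta> (\<lambda>_. 0))"
proof -
  have "tri_matrix (\<lambda>_. 0) \<theta> (\<lambda>_. 0) i j = (if i = j then \<theta> i else 0)" for i j
    by (simp add: tri_matrix_def)
  then show ?thesis by (simp add: has_matrix_iff[OF assms] diagonal_with_def)
qed

lemma has_matrix_apply:
  assumes "Vector_Spaces.linear scale scale A" "has_matrix d v A M"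
  shows "A (\<Sum>j\<le>d. c j *s v j) = (\<Sum>i\<le>d. (\<Sum>j\<le>d. M i j * c j) *s v i)"
proof -
  interpret A: Vector_Spaces.linear scale scale A by fact
  have "A (\<Sum>j\<le>d. c j *s v j) = (\<Sum>j\<le>d. c j *s (\<Sum>i\<le>d. M i j *s v i))"
    using assms(2) by (simp add: A.sum A.scale has_matrix_def)
  also have "\<dots> = (\<Sum>j\<le>d. \<Sum>i\<le>d. (M i j * c j) *s v i)"
    by (simp add: scale_sum_right mult.commute)
  also have "\<dots> = (\<Sum>i\<le>d. (\<Sum>j\<le>d. M i j * c j) *s v i)"
    by (subst sum.swap) (simp add: scale_sum_left)
  finally show ?thesis .
qed

text \<open>The condition is \<open>M Q = Q T\<close> instead of \<open>T = Q^-1 M Q\<close>, so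
  that no transition matrix has to be inverted explicitly.\<close>

lemma has_matrix_change_basis:
  assumes "Vector_Spaces.linear scale scale A" "has_matrix d v A M"
    and "\<And>j. j \<le> d \<Longrightarrow> w j = (\<Sum>i\<le>d. Q i j *s v i)"
    and "\<And>i j. i \<le> d \<Longrightarrow> j \<le> d \<Longrightarrow> (\<Sum>k\<le>d. M i k * Q k j) = (\<Sum>k\<le>d. Q i k * T k j)"
  shows "has_matrix d w A T"
  unfolding has_matrix_def
proof (intro allI impI)
  fix j assume j: "j \<le> d"
  have "A (w j) = (\<Sum>i\<le>d. (\<Sum>k\<le>d. M i k * Q k j) *s v i)"
    using j by (simp add: assms(3) has_matrix_apply[OF assms(1,2)])
  also have "\<dots> = (\<Sum>i\<le>d. (\<Sum>k\<le>d. Q i k * T k j) *s v i)"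
    using j assms(4) by simp
  also have "\<dots> = (\<Sum>k\<le>d. T k j *s (\<Sum>i\<le>d. Q i k *s v i))"
    unfolding scale_sum_right scale_sum_left by (subst sum.swap) (simp add: mult.commute)
  also have "\<dots> = (\<Sum>k\<le>d. T k j *s w k)"
    by (simp add: assms(3))
  finally show "A (w j) = (\<Sum>k\<le>d. T k j *s w k)" .
qed

text \<open>The space has dimension \<open>d + 1\<close>, so a spanning set with at most
  \<open>d + 1\<close> elements is independent; counting it again excludes repetitions in the
  family.\<close>

lemma indexed_basis_of_span:
  assumes "indexed_basis scale d v" "span (w ` {..d}) = UNIV"
  shows "indexed_basis scale d w"
proof -
  note b = indexed_basisD[OF assms(1)]
  interpret finite_dimensional_vector_space scale "v ` {..d}"
    by unfold_locales (use b in auto)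
  have dim: "dim UNIV = Suc d"
    using dim_eq_card[of "v ` {..d}" UNIV] b by (simp add: card_image)
  have c: "card (w ` {..d}) \<le> Suc d"
    using card_image_le[of "{..d}" w] by simp
  have "independent (w ` {..d})"
    using card_le_dim_spanning[of "w ` {..d}" UNIV] assms(2) dim c by auto
  moreover from this have "card (w ` {..d}) = Suc d"
    using dim_eq_card[of "w ` {..d}" UNIV] assms(2) dim by auto
  then have "inj_on w {..d}"
    by (intro eq_card_imp_inj_on) auto
  ultimately show ?thesis using assms(2) by (simp add: indexed_basis_def)
qed

text \<open>\<open>f\<close> ranks the indices. Since \<open>v j = w j - (w j - v j)\<close> and the
  difference involves only vectors \<open>v k\<close> of smaller rank, induction on the rank
  expresses every \<open>v j\<close> through the \<open>w k\<close>.\<close>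

lemma unitriangular_mem_span:
  fixes f :: "nat \<Rightarrow> nat"
  assumes "\<And>j. j \<le> d \<Longrightarrow> w j - v j \<in> span (v ` {k. k \<le> d \<and> f k < f j})"
  shows "j \<le> d \<Longrightarrow> v j \<in> span (w ` {k. k \<le> d \<and> f k \<le> f j})"
proof (induction "f j" arbitrary: j rule: less_induct)
  case less
  have "v ` {k. k \<le> d \<and> f k < f j} \<subseteq> span (w ` {k. k \<le> d \<and> f k \<le> f j})"
  proof safe
    fix k assume k: "k \<le> d" "f k < f j"
    have "v k \<in> span (w ` {i. i \<le> d \<and> f i \<le> f k})"
      using less.hyps k by blast
    also have "\<dots> \<subseteq> span (w ` {k. k \<le> d \<and> f k \<le> f j})"
      using k by (intro span_mono) auto
    finally show "v k \<in> span (w ` {k. k \<le> d \<and> f k \<le> f j})" .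
  qed
  then have "span (v ` {k. k \<le> d \<and> f k < f j}) \<subseteq> span (w ` {k. k \<le> d \<and> f k \<le> f j})"
    by (simp add: span_minimal)
  then have "w j - v j \<in> span (w ` {k. k \<le> d \<and> f k \<le> f j})"
    using assms less.prems by blast
  moreover have "w j \<in> span (w ` {k. k \<le> d \<and> f k \<le> f j})"
    using less.prems by (intro span_base) auto
  ultimately have "w j - (w j - v j) \<in> span (w ` {k. k \<le> d \<and> f k \<le> f j})"
    by (rule span_diff[rotated])
  then show ?case by simp
qed

lemma unitriangular_indexed_basis:
  fixes f :: "nat \<Rightarrow> nat"
  assumes "indexed_basis scale d v"
    and "\<And>j. j \<le> d \<Longrightarrow> w j - v j \<in> span (v ` {k. k \<le> d \<and> f k < f j})"
  shows "indexed_basis scale d w"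
proof (rule indexed_basis_of_span[OF assms(1)])
  have "v ` {..d} \<subseteq> span (w ` {..d})"
  proof safe
    fix j assume "j \<le> d"
    then have "v j \<in> span (w ` {k. k \<le> d \<and> f k \<le> f j})"
      using unitriangular_mem_span[OF assms(2)] by blast
    also have "\<dots> \<subseteq> span (w ` {..d})" by (intro span_mono) auto
    finally show "v j \<in> span (w ` {..d})" .
  qed
  then have "span (v ` {..d}) \<subseteq> span (w ` {..d})" by (simp add: span_minimal)
  then show "span (w ` {..d}) = UNIV" using indexed_basisD[OF assms(1)] by auto
qed

text \<open>The rank \<open>id\<close> covers upper unitriangular transition matrices, the rank
  \<open>d - i\<close> lower unitriangular ones.\<close>

lemma unitriangular_matrix_indexed_basis:
  fixes f :: "nat \<Rightarrow> nat"
  assumes "indexed_basis scale d v"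
    and w: "\<And>j. j \<le> d \<Longrightarrow> w j = (\<Sum>i\<le>d. Q i j *s v i)"
    and Q: "\<And>i. Q i i = 1" "\<And>i j. i \<le> d \<Longrightarrow> j \<le> d \<Longrightarrow> i \<noteq> j \<Longrightarrow> f j \<le> f i \<Longrightarrow> Q i j = 0"
  shows "indexed_basis scale d w"
proof (rule unitriangular_indexed_basis[where f = f, OF assms(1)])
  fix j assume j: "j \<le> d"
  have "w j = v j + (\<Sum>i\<in>{..d} - {j}. Q i j *s v i)"
    using j by (simp add: w sum.remove[of _ j] Q)
  moreover have "(\<Sum>i\<in>{..d} - {j}. Q i j *s v i) \<in> span (v ` {k. k \<le> d \<and> f k < f j})"
  proof (rule span_sum)
    fix i assume i: "i \<in> {..d} - {j}"
    show "Q i j *s v i \<in> span (v ` {k. k \<le> d \<and> f k < f j})"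
    proof (cases "f i < f j")
      case True
      then show ?thesis using i by (intro span_scale span_base) auto
    next
      case False
      then show ?thesis using i j Q(2)[of i j] by (simp add: span_zero)
    qed
  qed
  ultimately show "w j - v j \<in> span (v ` {k. k \<le> d \<and> f k < f j})" by simp
qed

end

section \<open>Split bases and eigenbases of dual q-Krawtchouk type\<close>

text \<open>With \<open>r = q\<^sup>2\<close>, \<open>hs = 0\<close> and \<open>\<tau> = 0\<close>
  this is the first split sequence divided by \<open>m\<close>, where \<open>m\<close> and
  \<open>a\<close> are the coefficients of \<open>r ^ i\<close> in \<open>\<theta>s i\<close> and
  \<open>\<theta> i\<close>.\<close>

definition krawtchouk_split :: "nat \<Rightarrow> 'a::field \<Rightarrow> 'a \<Rightarrow> nat \<Rightarrow> 'a" where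
  "krawtchouk_split d r a k = a / r * (r ^ k - 1) * (r ^ k - r ^ Suc d)"

text \<open>Entry \<open>(i, i + n)\<close> of the matrix whose columns are eigenvectors of
  \<open>As\<close> in split coordinates. The eigenvector equation gives the denominators
  \<open>r ^ (i + n) - r ^ k\<close> for \<open>i \<le> k < i + n\<close>; their product is
  regrouped so that no factor depends on \<open>n\<close>, which makes the recursion in the column
  index immediate.\<close>

definition eigen_of_split :: "nat \<Rightarrow> 'a::field \<Rightarrow> 'a \<Rightarrow> nat \<Rightarrow> nat \<Rightarrow> 'a" where
  "eigen_of_split d r a i n =
     (\<Prod>t<n. krawtchouk_split d r a (Suc (i + t)) / (r ^ (i + t) * (r ^ Suc t - 1)))"

text \<open>Entry \<open>(i, i + n)\<close> of the transition back to the split basis, with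
  denominators \<open>r ^ i - r ^ k\<close> for \<open>i < k \<le> i + n\<close>.\<close>

definition split_of_eigen :: "nat \<Rightarrow> 'a::field \<Rightarrow> 'a \<Rightarrow> nat \<Rightarrow> nat \<Rightarrow> 'a" where
  "split_of_eigen d r a i n =
     (\<Prod>t<n. krawtchouk_split d r a (Suc (i + t)) / (r ^ i * (1 - r ^ Suc t)))"

text \<open>The recursion in the row index is the eigenvector equation of \<open>As\<close> up to
  the factor \<open>m\<close>. The regrouped product hides it, hence the induction, which peels off
  the last factor.\<close>

lemma eigen_of_split_Suc_left:
  fixes r :: "'a::field"
  assumes "r \<noteq> 0" "\<And>k. k \<in> {1..d} \<Longrightarrow> r ^ k \<noteq> 1" "n < d"
  shows "eigen_of_split d r a i (Suc n) * (r ^ i * (r ^ Suc n - 1))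
    = eigen_of_split d r a (Suc i) n * krawtchouk_split d r a (Suc i)"
  using assms(3)
proof (induction n)
  case 0
  then show ?case using assms(1) assms(2)[of 1] by (simp add: eigen_of_split_def)
next
  case (Suc n)
  let ?f = "krawtchouk_split d r a"
  have nz: "r ^ Suc n \<noteq> 1" "r ^ Suc (Suc n) \<noteq> 1"
    using Suc.prems by (auto intro!: assms(2) simp del: power_Suc)
  have "eigen_of_split d r a i (Suc (Suc n)) * (r ^ i * (r ^ Suc (Suc n) - 1))
    = eigen_of_split d r a i (Suc n) * ?f (Suc (i + Suc n)) / r ^ Suc n"
    using nz assms(1) by (simp add: eigen_of_split_def power_add mult_ac del: power_Suc)
  also have "\<dots> = (eigen_of_split d r a i (Suc n) * (r ^ i * (r ^ Suc n - 1))) *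
      (?f (Suc (i + Suc n)) / (r ^ (Suc i + n) * (r ^ Suc n - 1)))"
    using nz assms(1) by (simp add: field_simps power_add)
  also have "\<dots> = (eigen_of_split d r a (Suc i) n * ?f (Suc i)) *
      (?f (Suc (i + Suc n)) / (r ^ (Suc i + n) * (r ^ Suc n - 1)))"
    using Suc by (simp del: power_Suc)
  also have "\<dots> = eigen_of_split d r a (Suc i) (Suc n) * ?f (Suc i)"
    by (simp add: eigen_of_split_def del: power_Suc)
  finally show ?case .
qed

text \<open>Passing from \<open>i\<close> to \<open>i + 1\<close> changes the power
  \<open>r ^ i\<close> in each of \<open>n\<close> denominators; this is the origin of the factor
  \<open>r ^ n\<close>.\<close>

lemma split_of_eigen_Suc_left:
  fixes r :: "'a::field"
  assumes "r \<noteq> 0" "\<And>k. k \<in> {1..d} \<Longrightarrow> r ^ k \<noteq> 1" "n < d"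
  shows "split_of_eigen d r a i (Suc n) * (r ^ i * (1 - r ^ Suc n))
    = split_of_eigen d r a (Suc i) n * krawtchouk_split d r a (Suc i) * r ^ n"
  using assms(3)
proof (induction n)
  case 0
  then show ?case using assms(1) assms(2)[of 1] by (simp add: split_of_eigen_def)
next
  case (Suc n)
  let ?f = "krawtchouk_split d r a"
  have nz: "1 - r ^ Suc n \<noteq> 0" "1 - r ^ Suc (Suc n) \<noteq> 0"
    using Suc.prems assms(2)[of "Suc n"] assms(2)[of "Suc (Suc n)"] by (auto simp del: power_Suc)
  have "split_of_eigen d r a i (Suc (Suc n)) * (r ^ i * (1 - r ^ Suc (Suc n)))
    = split_of_eigen d r a i (Suc n) * ?f (Suc (i + Suc n))"
    using nz assms(1) by (simp add: split_of_eigen_def del: power_Suc)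
  also have "\<dots> = (split_of_eigen d r a i (Suc n) * (r ^ i * (1 - r ^ Suc n))) *
      (?f (Suc (i + Suc n)) / (r ^ Suc i * (1 - r ^ Suc n))) * r"
    using nz assms(1) by (simp add: field_simps)
  also have "\<dots> = (split_of_eigen d r a (Suc i) n * ?f (Suc i) * r ^ n) *
      (?f (Suc (i + Suc n)) / (r ^ Suc i * (1 - r ^ Suc n))) * r"
    using Suc by (simp del: power_Suc)
  also have "\<dots> = split_of_eigen d r a (Suc i) (Suc n) * ?f (Suc i) * r ^ Suc n"
    by (simp add: split_of_eigen_def)
  finally show ?case .
qed

text \<open>The two rational identities behind the changes of basis, in terms of \<open>I = r ^ i\<close>,
  \<open>N = r ^ n\<close>, \<open>D = r ^ (d + 1)\<close>, with the index of the other basis equal to \<open>i + n\<close>.\<close>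

lemma eigen_of_split_identity:
  fixes I N D a b r :: "'a::field"
  assumes "I \<noteq> 0" "N \<noteq> 0" "r \<noteq> 0" "r * N - 1 \<noteq> 0"
  shows "(\<delta> + a * I + b / I) + a * (I - 1) * (I - D) / (I * (r * N - 1))
    = a / r * (r * (I * N) - 1) * (r * (I * N) - D) / (I * N * (r * N - 1))
      + (\<delta> + (a * D / r + b) / (I * N)) + b / (I * N) * (N - 1)"
proof -
  have nz: "r * N \<noteq> 1" using assms(4) by simp
  \<comment> \<open>The identity is linear in \<open>\<delta>\<close>, \<open>a\<close> and
    \<open>b\<close>: \<open>\<delta>\<close> occurs once on each side, this is the part in
    \<open>b\<close>, and the part in \<open>a\<close> follows.\<close>
  have "b / I = b / (I * N) + b / (I * N) * (N - 1)"
    using assms by (simp add: field_simps)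
  moreover have "a * I + a * (I - 1) * (I - D) / (I * (r * N - 1))
    = a / r * (r * (I * N) - 1) * (r * (I * N) - D) / (I * N * (r * N - 1)) + a * D / r / (I * N)"
    using assms(1-3) nz by (simp add: divide_simps) algebra
  ultimately show ?thesis by (simp add: add_divide_distrib)
qed

lemma split_of_eigen_identity:
  fixes I N D a b r :: "'a::field"
  assumes "I \<noteq> 0" "N \<noteq> 0" "r \<noteq> 0" "1 - r * N \<noteq> 0"
  shows "a * (I - 1) * (I - D) * N / (I * (1 - r * N)) + (\<delta> + (a * D / r + b) / I)
      + b * (1 - N) / (I * N)
    = (\<delta> + a * (I * N) + b / (I * N)) + a / r * (r * (I * N) - 1) * (r * (I * N) - D) / (I * (1 - r * N))"
proof -
  have nz: "r * N \<noteq> 1" using assms(4) by simp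
  have "b / (I * N) = b / I + b * (1 - N) / (I * N)"
    using assms by (simp add: field_simps)
  moreover have "a * (I - 1) * (I - D) * N / (I * (1 - r * N)) + a * D / r / I
    = a * (I * N) + a / r * (r * (I * N) - 1) * (r * (I * N) - D) / (I * (1 - r * N))"
    using assms(1-3) nz by (simp add: divide_simps) algebra
  ultimately show ?thesis by (simp add: add_divide_distrib)
qed

text \<open>In use \<open>c = a * b\<close>. Keeping only the product visible lets the same matrix
  be read for any other pair with that product.\<close>

definition krawtchouk_offdiag :: "nat \<Rightarrow> 'a::field \<Rightarrow> 'a \<Rightarrow> nat \<Rightarrow> 'a" where
  "krawtchouk_offdiag d r c k = c * (r ^ k - 1) * (r ^ k - r ^ Suc d) / r ^ (2 * k)"

lemma krawtchouk_offdiag_eq_split: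
  "r \<noteq> 0 \<Longrightarrow> krawtchouk_offdiag d r (a * b) k = b * r * krawtchouk_split d r a k / r ^ (2 * k)"
  by (simp add: krawtchouk_offdiag_def krawtchouk_split_def)

definition eigen_of_split_matrix :: "nat \<Rightarrow> 'a::field \<Rightarrow> 'a \<Rightarrow> nat \<Rightarrow> nat \<Rightarrow> 'a" where
  "eigen_of_split_matrix d r a i j = (if i \<le> j then eigen_of_split d r a i (j - i) else 0)"

definition split_of_eigen_matrix :: "nat \<Rightarrow> 'a::field \<Rightarrow> 'a \<Rightarrow> nat \<Rightarrow> nat \<Rightarrow> 'a" where
  "split_of_eigen_matrix d r a i j = (if i \<le> j then split_of_eigen d r a i (j - i) else 0)"

section \<open>Transition matrices as intertwiners of \<open>A\<close> and \<open>As\<close>\<close>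

context
  fixes r :: "'a::field" and d :: nat
  assumes r0: "r \<noteq> 0" and r1: "\<And>k. k \<in> {1..d} \<Longrightarrow> r ^ k \<noteq> 1"
begin

text \<open>Compared entrywise: on and above the diagonal the neighbours of \<open>X\<close>, the
  entry \<open>(i, j)\<close>, are explicit rational multiples of \<open>X\<close>. After
  \<open>X\<close> is factored out, \<open>eigen_of_split_identity\<close> remains, with
  \<open>I = r ^ i\<close>, \<open>N = r ^ n\<close> and \<open>D = r ^ Suc d\<close>.\<close>

lemma eigen_of_split_intertwines_A:
  assumes "i \<le> d" "j \<le> d"
  shows "(\<Sum>k\<le>d. tri_matrix (\<lambda>_. 1) (\<lambda>i. \<delta> + a * r ^ i + b / r ^ i) (\<lambda>_. 0) i k * eigen_of_split_matrix d r a k j)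
    = (\<Sum>k\<le>d. eigen_of_split_matrix d r a i k *
         tri_matrix (\<lambda>_. 1) (\<lambda>i. \<delta> + (a * r ^ d + b) / r ^ i) (krawtchouk_offdiag d r (a * b)) k j)"
proof -
  let ?Q = "eigen_of_split_matrix d r a" and ?f = "krawtchouk_split d r a"
    and ?x = "krawtchouk_offdiag d r (a * b)" and ?g = "eigen_of_split d r a"
  have "(\<delta> + a * r ^ i + b / r ^ i) * ?Q i j + (if 0 < i then ?Q (i - 1) j else 0)
    = (if j < d then ?Q i (Suc j) else 0) + (\<delta> + (a * r ^ d + b) / r ^ j) * ?Q i j
      + (if 0 < j then ?x j * ?Q i (j - 1) else 0)"
  proof (cases "i \<le> j")
    \<comment> \<open>Below the diagonal only \<open>i = j + 1\<close> contributes, with a 1 on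
      either side.\<close>
    case False
    then show ?thesis using assms by (auto simp: eigen_of_split_matrix_def eigen_of_split_def)
  next
    case True
    then obtain n where j: "j = i + n" using le_Suc_ex by blast
    define X where "X = ?g i n"
    have Q: "?Q i j = X" by (simp add: eigen_of_split_matrix_def j X_def)
    have x: "(if 0 < j then ?x j * ?Q i (j - 1) else 0) = b / (r ^ i * r ^ n) * (r ^ n - 1) * X"
    proof (cases n)
      case 0
      then show ?thesis using j by (auto simp: eigen_of_split_matrix_def)
    next
      case (Suc n')
      have nz: "r ^ Suc n' - 1 \<noteq> 0" using r1[of "Suc n'"] assms j Suc by simp
      have "?Q i (j - 1) = ?g i n'" by (simp add: eigen_of_split_matrix_def j Suc)
      moreover have "?g i n' * ?f j = X * (r ^ (i + n') * (r ^ Suc n' - 1))"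
        using nz r0 by (simp add: X_def Suc eigen_of_split_def j del: power_Suc)
      ultimately have "?x j * ?Q i (j - 1) = b * r * (X * (r ^ (i + n') * (r ^ Suc n' - 1))) / r ^ (2 * j)"
        unfolding krawtchouk_offdiag_eq_split[OF r0] by (simp add: mult_ac)
      also have "\<dots> = b / (r ^ i * r ^ n) * (r ^ n - 1) * X"
        using r0 Suc j by (simp add: field_simps mult_2 mult_2_right power_add)
      finally show ?thesis using j Suc by simp
    qed
    \<comment> \<open>The factor \<open>r ^ Suc n - 1\<close> is known to be nonzero only for
      \<open>n < d\<close>. The remaining corner \<open>i = 0\<close>, \<open>j = d\<close> has
      neither a neighbour at \<open>i - 1\<close> nor one at \<open>j + 1\<close>.\<close>
    show ?thesis
    proof (cases "n < d")
      case True
      have nz: "r ^ Suc n - 1 \<noteq> 0" using r1[of "Suc n"] True by simp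
      \<comment> \<open>Both formulas extend to the border: for \<open>i = 0\<close> the factor
        \<open>r ^ i - 1\<close> vanishes, and in \<open>u\<close> below, for \<open>j = d\<close>,
        the factor \<open>r * (r ^ i * r ^ n) - r ^ Suc d\<close>.\<close>
      have l: "(if 0 < i then ?Q (i - 1) j else 0)
          = a * (r ^ i - 1) * (r ^ i - r ^ Suc d) / (r ^ i * (r * r ^ n - 1)) * X"
      proof (cases i)
        case (Suc i')
        have "?Q (i - 1) j = ?g i' (Suc n)" by (simp add: eigen_of_split_matrix_def j Suc Suc_diff_le)
        also have "\<dots> = X * ?f i / (r ^ i' * (r ^ Suc n - 1))"
          using eigen_of_split_Suc_left[OF r0 r1 True, of a i'] nz r0
          by (simp add: X_def Suc eq_divide_eq del: power_Suc)
        also have "\<dots> = a * (r ^ i - 1) * (r ^ i - r ^ Suc d) / (r ^ i * (r * r ^ n - 1)) * X"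
          using r0 by (simp add: krawtchouk_split_def Suc mult_ac)
        finally show ?thesis by (simp add: Suc)
      qed auto
      have u: "(if j < d then ?Q i (Suc j) else 0)
          = a / r * (r * (r ^ i * r ^ n) - 1) * (r * (r ^ i * r ^ n) - r ^ Suc d)
              / (r ^ i * r ^ n * (r * r ^ n - 1)) * X"
      proof (cases "j = d")
        case False
        then have "j < d" using assms by simp
        then show ?thesis
          by (simp add: eigen_of_split_matrix_def eigen_of_split_def Suc_diff_le j X_def
              krawtchouk_split_def power_add mult_ac)
      qed (simp add: j[symmetric] power_add[symmetric])
      have D: "a * r ^ d = a * r ^ Suc d / r" using r0 by simp
      have "r * r ^ n - 1 \<noteq> 0" using nz by simp
      then show ?thesis
        unfolding l u x Q unfolding j power_add D distrib_right[symmetric] using r0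
        by (intro arg_cong[where f = "\<lambda>y. y * X"] eigen_of_split_identity) auto
    next
      case False
      then have "n = d" "i = 0" "j = d" using assms j by auto
      then show ?thesis unfolding x Q using r0 by (simp add: field_simps)
    qed
  qed
  then show ?thesis
    unfolding sum_tri_matrix_row[OF assms(1)] sum_tri_matrix_col[OF assms(2)]
    by (simp add: mult_ac add_ac split del: if_split cong: if_cong)
qed

text \<open>For \<open>i < j\<close> this is the row recursion times \<open>m\<close>, because the
  eigenvalues at \<open>j\<close> and \<open>i\<close> differ by
  \<open>m * r ^ i * (r ^ (j - i) - 1)\<close>.\<close>

lemma eigen_of_split_intertwines_As:
  assumes "i \<le> d" "j \<le> d"
  shows "(\<Sum>k\<le>d. tri_matrix (\<lambda>_. 0) (\<lambda>i. \<delta> + m * r ^ i) (\<lambda>i. m * krawtchouk_split d r a i) i k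
            * eigen_of_split_matrix d r a k j)
    = (\<Sum>k\<le>d. eigen_of_split_matrix d r a i k * tri_matrix (\<lambda>_. 0) (\<lambda>i. \<delta> + m * r ^ i) (\<lambda>_. 0) k j)"
proof -
  let ?Q = "eigen_of_split_matrix d r a" and ?f = "krawtchouk_split d r a"
  consider "j < i" | "i = j" | "i < j" by linarith
  then have "(\<delta> + m * r ^ i) * ?Q i j + (if i < d then m * ?f (Suc i) * ?Q (Suc i) j else 0)
    = (\<delta> + m * r ^ j) * ?Q i j"
  proof cases
    case 3
    then obtain n where j: "j = i + Suc n" using less_imp_Suc_add by auto
    have "eigen_of_split d r a i (Suc n) * (r ^ i * (r ^ Suc n - 1)) = eigen_of_split d r a (Suc i) n * ?f (Suc i)"
      using assms j by (intro eigen_of_split_Suc_left r0 r1) auto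
    from arg_cong[OF this, of "\<lambda>y. m * y"] show ?thesis using 3 assms
      by (simp add: eigen_of_split_matrix_def j algebra_simps power_add)
  qed (auto simp: eigen_of_split_matrix_def)
  then show ?thesis
    unfolding sum_tri_matrix_row[OF assms(1)] sum_tri_matrix_col[OF assms(2)]
    by (simp add: mult_ac add_ac split del: if_split cong: if_cong)
qed

text \<open>As in the other direction, each neighbour is a rational multiple of the entry
  \<open>(i, j)\<close>: the row recursion gives those at \<open>i - 1\<close> and
  \<open>i + 1\<close>, the product formula the one at \<open>j + 1\<close>.\<close>

lemma split_of_eigen_intertwines_A:
  assumes "i \<le> d" "j \<le> d"
  shows "(\<Sum>k\<le>d. tri_matrix (\<lambda>_. 1) (\<lambda>i. \<delta> + (a * r ^ d + b) / r ^ i) (krawtchouk_offdiag d r (a * b)) i k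
            * split_of_eigen_matrix d r a k j)
    = (\<Sum>k\<le>d. split_of_eigen_matrix d r a i k *
         tri_matrix (\<lambda>_. 1) (\<lambda>i. \<delta> + a * r ^ i + b / r ^ i) (\<lambda>_. 0) k j)"
proof -
  let ?P = "split_of_eigen_matrix d r a" and ?f = "krawtchouk_split d r a"
    and ?x = "krawtchouk_offdiag d r (a * b)" and ?p = "split_of_eigen d r a"
  have "(if 0 < i then ?P (i - 1) j else 0) + (\<delta> + (a * r ^ d + b) / r ^ i) * ?P i j
      + (if i < d then ?x (Suc i) * ?P (Suc i) j else 0)
    = (\<delta> + a * r ^ j + b / r ^ j) * ?P i j + (if j < d then ?P i (Suc j) else 0)"
  proof (cases "i \<le> j")
    case False
    then show ?thesis using assms by (auto simp: split_of_eigen_matrix_def split_of_eigen_def)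
  next
    case True
    then obtain n where j: "j = i + n" using le_Suc_ex by blast
    define X where "X = ?p i n"
    have P: "?P i j = X" by (simp add: split_of_eigen_matrix_def j X_def)
    have x: "(if i < d then ?x (Suc i) * ?P (Suc i) j else 0) = b * (1 - r ^ n) / (r ^ i * r ^ n) * X"
    proof (cases n)
      case 0
      then show ?thesis using j by (auto simp: split_of_eigen_matrix_def)
    next
      case (Suc n')
      have "?P (Suc i) j = ?p (Suc i) n'" by (simp add: split_of_eigen_matrix_def j Suc)
      moreover have "X * (r ^ i * (1 - r ^ Suc n')) = ?p (Suc i) n' * ?f (Suc i) * r ^ n'"
        unfolding X_def Suc using assms j Suc by (intro split_of_eigen_Suc_left r0 r1) auto
      then have "?p (Suc i) n' * ?f (Suc i) = X * (r ^ i * (1 - r ^ Suc n')) / r ^ n'"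
        using r0 by (simp add: eq_divide_eq)
      ultimately have "?x (Suc i) * ?P (Suc i) j
          = b * r * (X * (r ^ i * (1 - r ^ Suc n')) / r ^ n') / r ^ (2 * Suc i)"
        unfolding krawtchouk_offdiag_eq_split[OF r0] by (simp add: mult_ac)
      also have "\<dots> = b * (1 - r ^ n) / (r ^ i * r ^ n) * X"
        using r0 Suc by (simp add: field_simps mult_2 mult_2_right power_add)
      finally show ?thesis using assms j Suc by simp
    qed
    show ?thesis
    proof (cases "n < d")
      case True
      have nz: "1 - r ^ Suc n \<noteq> 0" using r1[of "Suc n"] True by simp
      have l: "(if 0 < i then ?P (i - 1) j else 0)
          = a * (r ^ i - 1) * (r ^ i - r ^ Suc d) * r ^ n / (r ^ i * (1 - r * r ^ n)) * X"
      proof (cases i)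
        case (Suc i')
        have "?P (i - 1) j = ?p i' (Suc n)" by (simp add: split_of_eigen_matrix_def j Suc Suc_diff_le)
        also have "\<dots> = X * ?f i * r ^ n / (r ^ i' * (1 - r ^ Suc n))"
          using split_of_eigen_Suc_left[OF r0 r1 True, of a i'] nz r0
          by (simp add: X_def Suc eq_divide_eq del: power_Suc)
        also have "\<dots> = a * (r ^ i - 1) * (r ^ i - r ^ Suc d) * r ^ n / (r ^ i * (1 - r * r ^ n)) * X"
          using r0 by (simp add: krawtchouk_split_def Suc mult_ac)
        finally show ?thesis by (simp add: Suc)
      qed auto
      have u: "(if j < d then ?P i (Suc j) else 0)
          = a / r * (r * (r ^ i * r ^ n) - 1) * (r * (r ^ i * r ^ n) - r ^ Suc d)
              / (r ^ i * (1 - r * r ^ n)) * X"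
      proof (cases "j = d")
        case False
        then have "j < d" using assms by simp
        then show ?thesis
          by (simp add: split_of_eigen_matrix_def split_of_eigen_def Suc_diff_le j X_def
              krawtchouk_split_def power_add mult_ac)
      qed (simp add: j[symmetric] power_add[symmetric])
      have D: "a * r ^ d = a * r ^ Suc d / r" using r0 by simp
      have "1 - r * r ^ n \<noteq> 0" using nz by simp
      then show ?thesis
        unfolding l u x P unfolding j power_add D distrib_right[symmetric] using r0
        by (intro arg_cong[where f = "\<lambda>y. y * X"] split_of_eigen_identity) auto
    next
      case False
      then have "n = d" "i = 0" "j = d" using assms j by auto
      then show ?thesis unfolding x P using r0 by (simp add: field_simps)
    qed
  qed
  then show ?thesis
    unfolding sum_tri_matrix_row[OF assms(1)] sum_tri_matrix_col[OF assms(2)]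
    by (simp add: mult_ac add_ac split del: if_split cong: if_cong)
qed

text \<open>For \<open>i < j\<close> this is the column recursion, which the product formula
  contains as its last factor.\<close>

lemma split_of_eigen_intertwines_As:
  assumes "i \<le> d" "j \<le> d"
  shows "(\<Sum>k\<le>d. tri_matrix (\<lambda>_. 0) (\<lambda>i. \<delta> + m * r ^ i) (\<lambda>_. 0) i k * split_of_eigen_matrix d r a k j)
    = (\<Sum>k\<le>d. split_of_eigen_matrix d r a i k
         * tri_matrix (\<lambda>_. 0) (\<lambda>i. \<delta> + m * r ^ i) (\<lambda>i. m * krawtchouk_split d r a i) k j)"
proof -
  let ?P = "split_of_eigen_matrix d r a" and ?f = "krawtchouk_split d r a"
  consider "j < i" | "i = j" | "i < j" by linarith
  then have "(\<delta> + m * r ^ i) * ?P i j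
    = (\<delta> + m * r ^ j) * ?P i j + (if 0 < j then m * ?f j * ?P i (j - 1) else 0)"
  proof cases
    case 3
    then obtain n where j: "j = i + Suc n" using less_imp_Suc_add by auto
    have nz: "1 - r ^ Suc n \<noteq> 0" using assms j r1[of "Suc n"] by simp
    then have "split_of_eigen d r a i (Suc n) * (r ^ i * (1 - r ^ Suc n)) = split_of_eigen d r a i n * ?f j"
      using r0 by (simp add: split_of_eigen_def j del: power_Suc)
    from arg_cong[OF this, of "\<lambda>y. m * y"] show ?thesis using 3 assms
      by (simp add: split_of_eigen_matrix_def j algebra_simps power_add)
  qed (auto simp: split_of_eigen_matrix_def)
  then show ?thesis
    unfolding sum_tri_matrix_row[OF assms(1)] sum_tri_matrix_col[OF assms(2)]
    by (simp add: mult_ac add_ac split del: if_split cong: if_cong)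
qed

end

section \<open>Passing between split bases and eigenbases of \<open>As\<close>\<close>

context scalar_space
begin

lemma krawtchouk_eigenbasis_of_split:
  assumes "r \<noteq> 0" "\<And>k. k \<in> {1..d} \<Longrightarrow> r ^ k \<noteq> 1" "indexed_basis scale d v"
    and "Vector_Spaces.linear scale scale A" "Vector_Spaces.linear scale scale As"
    and "has_matrix d v A (tri_matrix (\<lambda>_. 1) (\<lambda>i. \<delta> + a * r ^ i + b / r ^ i) (\<lambda>_. 0))"
    and "has_matrix d v As (tri_matrix (\<lambda>_. 0) (\<lambda>i. \<delta>s + m * r ^ i) (\<lambda>i. m * krawtchouk_split d r a i))"
  obtains w where "indexed_basis scale d w"
    "has_matrix d w A (tri_matrix (\<lambda>_. 1) (\<lambda>i. \<delta> + (a * r ^ d + b) / r ^ i) (krawtchouk_offdiag d r (a * b)))"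
    "has_matrix d w As (tri_matrix (\<lambda>_. 0) (\<lambda>i. \<delta>s + m * r ^ i) (\<lambda>_. 0))"
proof (rule that)
  let ?w = "\<lambda>j. \<Sum>i\<le>d. eigen_of_split_matrix d r a i j *s v i"
  show "indexed_basis scale d ?w"
    by (rule unitriangular_matrix_indexed_basis[where f = id, OF assms(3) refl])
      (simp_all add: eigen_of_split_matrix_def eigen_of_split_def)
  show "has_matrix d ?w A (tri_matrix (\<lambda>_. 1) (\<lambda>i. \<delta> + (a * r ^ d + b) / r ^ i) (krawtchouk_offdiag d r (a * b)))"
    by (rule has_matrix_change_basis[OF assms(4,6) refl eigen_of_split_intertwines_A[OF assms(1,2)]])
  show "has_matrix d ?w As (tri_matrix (\<lambda>_. 0) (\<lambda>i. \<delta>s + m * r ^ i) (\<lambda>_. 0))"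
    by (rule has_matrix_change_basis[OF assms(5,7) refl eigen_of_split_intertwines_As[OF assms(1,2)]])
qed

text \<open>The hypotheses see \<open>a\<close> and \<open>b\<close> only through
  \<open>a * r ^ d + b\<close> and \<open>a * b\<close>, so one eigenbasis yields a split basis for
  every pair with these two values.\<close>

lemma krawtchouk_split_of_eigenbasis:
  assumes "r \<noteq> 0" "\<And>k. k \<in> {1..d} \<Longrightarrow> r ^ k \<noteq> 1" "indexed_basis scale d w"
    and "Vector_Spaces.linear scale scale A" "Vector_Spaces.linear scale scale As"
    and "has_matrix d w A (tri_matrix (\<lambda>_. 1) (\<lambda>i. \<delta> + (a * r ^ d + b) / r ^ i) (krawtchouk_offdiag d r (a * b)))"
    and "has_matrix d w As (tri_matrix (\<lambda>_. 0) (\<lambda>i. \<delta>s + m * r ^ i) (\<lambda>_. 0))"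
  obtains v where "indexed_basis scale d v"
    "has_matrix d v A (tri_matrix (\<lambda>_. 1) (\<lambda>i. \<delta> + a * r ^ i + b / r ^ i) (\<lambda>_. 0))"
    "has_matrix d v As (tri_matrix (\<lambda>_. 0) (\<lambda>i. \<delta>s + m * r ^ i) (\<lambda>i. m * krawtchouk_split d r a i))"
proof (rule that)
  let ?v = "\<lambda>j. \<Sum>i\<le>d. split_of_eigen_matrix d r a i j *s w i"
  show "indexed_basis scale d ?v"
    by (rule unitriangular_matrix_indexed_basis[where f = id, OF assms(3) refl])
      (simp_all add: split_of_eigen_matrix_def split_of_eigen_def)
  show "has_matrix d ?v A (tri_matrix (\<lambda>_. 1) (\<lambda>i. \<delta> + a * r ^ i + b / r ^ i) (\<lambda>_. 0))"
    by (rule has_matrix_change_basis[OF assms(4,6) refl split_of_eigen_intertwines_A[OF assms(1,2)]])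
  show "has_matrix d ?v As (tri_matrix (\<lambda>_. 0) (\<lambda>i. \<delta>s + m * r ^ i) (\<lambda>i. m * krawtchouk_split d r a i))"
    by (rule has_matrix_change_basis[OF assms(5,7) refl split_of_eigen_intertwines_As[OF assms(1,2)]])
qed

end

section \<open>Eigenspaces and the flat part\<close>

context scalar_space
begin

lemma linear_endoI:
  "(\<And>x y. f (x + y) = f x + f y) \<Longrightarrow> (\<And>c x. f (c *s x) = c *s f x) \<Longrightarrow> Vector_Spaces.linear scale scale f"
  by unfold_locales auto

lemma linear_endo_diff:
  assumes "Vector_Spaces.linear scale scale f" "Vector_Spaces.linear scale scale g"
  shows "Vector_Spaces.linear scale scale (f - g)"
proof -
  interpret f: Vector_Spaces.linear scale scale f by fact
  interpret g: Vector_Spaces.linear scale scale g by fact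
  show ?thesis
    by (rule linear_endoI) (simp_all add: f.add g.add f.scale g.scale scale_right_diff_distrib)
qed

lemma dim_UNIV_indexed_basis:
  assumes "indexed_basis scale d v"
  shows "dim UNIV = Suc d"
  using dim_eq_card[of "v ` {..d}" UNIV] indexed_basisD[OF assms] by (simp add: card_image)

lemma image_reverse_atMost: "(\<lambda>i. v (d - i)) ` {..d} = v ` {..d}" for v :: "nat \<Rightarrow> 'c"
proof safe
  fix i assume "i \<le> d"
  then show "v i \<in> (\<lambda>i. v (d - i)) ` {..d}"
    by (intro image_eqI[of _ _ "d - i"]) auto
qed auto

lemma indexed_basis_reverse:
  assumes "indexed_basis scale d v"
  shows "indexed_basis scale d (\<lambda>i. v (d - i))"
  by (rule indexed_basis_of_span[OF assms]) (simp add: image_reverse_atMost indexed_basisD[OF assms])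

lemma matrix_of_reverse:
  "matrix_of scale d (\<lambda>i. v (d - i)) A i j = matrix_of scale d v A (d - i) (d - j)"
  by (simp add: matrix_of_def image_reverse_atMost)

lemma eigenvector_coordinates:
  assumes "indexed_basis scale d v" "Vector_Spaces.linear scale scale A" "has_matrix d v A M"
    and "A x = t *s x" "i \<le> d"
  shows "(\<Sum>j\<le>d. M i j * representation (v ` {..d}) x (v j)) = t * representation (v ` {..d}) x (v i)"
proof -
  let ?c = "\<lambda>j. representation (v ` {..d}) x (v j)"
  have x: "x = (\<Sum>j\<le>d. ?c j *s v j)" by (rule indexed_basis_expand[OF assms(1)])
  have "(\<Sum>i\<le>d. (\<Sum>j\<le>d. M i j * ?c j) *s v i) = A (\<Sum>j\<le>d. ?c j *s v j)"
    by (rule has_matrix_apply[OF assms(2,3), symmetric])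
  also have "\<dots> = t *s (\<Sum>j\<le>d. ?c j *s v j)"
    using assms(4) x by simp
  also have "\<dots> = (\<Sum>i\<le>d. (t * ?c i) *s v i)"
    by (simp add: scale_sum_right)
  finally show ?thesis
    by (rule indexed_basis_coeff_eq[OF assms(1) _ assms(5)])
qed

lemma indexed_basis_eq_0:
  assumes "indexed_basis scale d v" "\<And>i. i \<le> d \<Longrightarrow> representation (v ` {..d}) x (v i) = 0"
  shows "x = 0"
  using indexed_basis_expand[OF assms(1), of x] assms(2) by simp

lemma indexed_basis_nonzero: "indexed_basis scale d v \<Longrightarrow> i \<le> d \<Longrightarrow> v i \<noteq> 0"
  by (metis atMost_iff dependent_zero imageI indexed_basisD(2))

lemma has_matrix_tri_matrix_diag_iff:
  "has_matrix d v A (tri_matrix (\<lambda>_. 0) \<theta> (\<lambda>_. 0)) \<longleftrightarrow> (\<forall>j\<le>d. A (v j) = \<theta> j *s v j)"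
proof -
  have "(\<Sum>i\<le>d. tri_matrix (\<lambda>_. 0) \<theta> (\<lambda>_. 0) i j *s v i) = \<theta> j *s v j" if "j \<le> d" for j
  proof -
    have "(\<Sum>i\<le>d. tri_matrix (\<lambda>_. 0) \<theta> (\<lambda>_. 0) i j *s v i) = (\<Sum>i\<le>d. if i = j then \<theta> j *s v j else 0)"
      by (rule sum.cong) (auto simp: tri_matrix_def)
    then show ?thesis using that by simp
  qed
  then show ?thesis by (simp add: has_matrix_def)
qed

lemma has_matrix_tri_matrix_diagD:
  "has_matrix d v A (tri_matrix (\<lambda>_. 0) \<theta> (\<lambda>_. 0)) \<Longrightarrow> j \<le> d \<Longrightarrow> A (v j) = \<theta> j *s v j"
  by (simp add: has_matrix_tri_matrix_diag_iff)

section \<open>Eigenvectors of a lower bidiagonal operator with unit subdiagonal\<close>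

lemma lower_bidiagonal_coordinates:
  assumes "indexed_basis scale d v" "Vector_Spaces.linear scale scale A"
    and "has_matrix d v A (tri_matrix (\<lambda>_. 1) \<theta> (\<lambda>_. 0))"
    and "A x = t *s x" "i \<le> d"
  shows "\<theta> i * representation (v ` {..d}) x (v i)
      + (if 0 < i then representation (v ` {..d}) x (v (i - 1)) else 0)
    = t * representation (v ` {..d}) x (v i)"
  using eigenvector_coordinates[OF assms] unfolding sum_tri_matrix_row[OF assms(5)] by (simp cong: if_cong)

text \<open>If \<open>t\<close> avoids the diagonal, the rows read from the top down force the
  coordinates of \<open>x\<close> to vanish one after the other.\<close>

lemma lower_bidiagonal_eigenvalue:
  assumes "indexed_basis scale d v" "Vector_Spaces.linear scale scale A"
    and "has_matrix d v A (tri_matrix (\<lambda>_. 1) \<theta> (\<lambda>_. 0))"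
    and "A x = t *s x" "x \<noteq> 0"
  shows "t \<in> \<theta> ` {..d}"
proof (rule ccontr)
  assume t: "t \<notin> \<theta> ` {..d}"
  let ?c = "\<lambda>j. representation (v ` {..d}) x (v j)"
  have "?c i = 0" if "i \<le> d" for i
    using that
  proof (induction i)
    case 0
    then show ?case using lower_bidiagonal_coordinates[OF assms(1-4) 0] t by auto
  next
    case (Suc i)
    then have "\<theta> (Suc i) * ?c (Suc i) = t * ?c (Suc i)"
      using lower_bidiagonal_coordinates[OF assms(1-4) Suc.prems] by simp
    then show ?case using t Suc.prems by auto
  qed
  then show False using indexed_basis_eq_0[OF assms(1)] assms(5) by blast
qed

text \<open>As the subdiagonal is 1, row \<open>i\<close> expresses coordinate \<open>i - 1\<close>
  as \<open>t - \<theta> i\<close> times coordinate \<open>i\<close>; the last coordinate therefore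
  determines all others.\<close>

lemma lower_bidiagonal_eigenvector_eq_0:
  assumes "indexed_basis scale d v" "Vector_Spaces.linear scale scale A"
    and "has_matrix d v A (tri_matrix (\<lambda>_. 1) \<theta> (\<lambda>_. 0))"
    and "A x = t *s x" "representation (v ` {..d}) x (v d) = 0"
  shows "x = 0"
proof -
  let ?c = "\<lambda>j. representation (v ` {..d}) x (v j)"
  have "?c (d - k) = 0" for k
  proof (induction k)
    case (Suc k)
    show ?case
    proof (cases "k < d")
      case True
      then have "\<theta> (d - k) * ?c (d - k) + ?c (d - Suc k) = t * ?c (d - k)"
        using lower_bidiagonal_coordinates[OF assms(1-4), of "d - k"] by simp
      then show ?thesis using Suc by simp
    qed (use Suc in simp)
  qed (use assms(5) in simp)
  then have "?c i = 0" if "i \<le> d" for i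
    using that by (metis diff_diff_cancel)
  then show ?thesis using indexed_basis_eq_0[OF assms(1)] by blast
qed

text \<open>Subtracting the multiple of \<open>y\<close> that cancels the last coordinate leaves a
  vector to which the preceding lemma applies. The same lemma shows that the last coordinate of
  \<open>y\<close> is nonzero.\<close>

lemma lower_bidiagonal_eigenspace:
  assumes "indexed_basis scale d v" "Vector_Spaces.linear scale scale A"
    and "has_matrix d v A (tri_matrix (\<lambda>_. 1) \<theta> (\<lambda>_. 0))"
    and "A x = t *s x" "A y = t *s y" "y \<noteq> 0"
  shows "\<exists>e. x = e *s y"
proof
  interpret A: Vector_Spaces.linear scale scale A by fact
  note b = indexed_basisD[OF assms(1)]
  let ?R = "representation (v ` {..d})"
  define e where "e = ?R x (v d) / ?R y (v d)"
  have "?R y (v d) \<noteq> 0"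
    using lower_bidiagonal_eigenvector_eq_0[OF assms(1-3,5)] assms(6) by blast
  then have "?R (x - e *s y) (v d) = 0"
    using b by (simp add: representation_diff representation_scale e_def)
  moreover have "A (x - e *s y) = t *s (x - e *s y)"
    by (simp add: A.diff A.scale assms(4,5) scale_right_diff_distrib mult.commute)
  ultimately have "x - e *s y = 0"
    by (intro lower_bidiagonal_eigenvector_eq_0[OF assms(1-3)])
  then show "x = e *s y" by simp
qed

lemma lower_bidiagonal_multiplicity_free_iff:
  assumes "indexed_basis scale d v" "Vector_Spaces.linear scale scale A"
    and "has_matrix d v A (tri_matrix (\<lambda>_. 1) \<theta> (\<lambda>_. 0))"
  shows "multiplicity_free scale A \<longleftrightarrow> diagonalizable scale A"
proof -
  have "dim (eigenspace scale A t) = 1" if t: "t \<in> eigenvalues scale A" for t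
  proof -
    obtain y where y: "y \<noteq> 0" "A y = t *s y" using t by (auto simp: eigenvalues_def)
    interpret A: Vector_Spaces.linear scale scale A by fact
    have "eigenspace scale A t = span {y}"
      using lower_bidiagonal_eigenspace[OF assms _ y(2,1)] y(2)
      by (auto simp: eigenspace_def span_singleton A.scale mult.commute)
    then show ?thesis
      using y(1) dim_eq_card[of "{y}" "span {y}"] by (simp add: span_span)
  qed
  then show ?thesis by (auto simp: multiplicity_free_def)
qed

text \<open>Eigenspaces are lines, so the \<open>d + 1\<close> members of an eigenbasis have
  distinct eigenvalues; these lie among the values of \<open>\<theta>\<close>, which therefore
  number \<open>d + 1\<close>.\<close>

lemma lower_bidiagonal_diagonalizable_imp_inj:
  assumes "indexed_basis scale d v" "Vector_Spaces.linear scale scale A"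
    and "has_matrix d v A (tri_matrix (\<lambda>_. 1) \<theta> (\<lambda>_. 0))"
    and "diagonalizable scale A"
  shows "inj_on \<theta> {..d}"
proof -
  obtain B where B: "independent B" "span B = UNIV" "\<forall>x\<in>B. \<exists>t. A x = t *s x"
    using assms(4) by (auto simp: diagonalizable_def)
  then obtain t where t: "\<And>x. x \<in> B \<Longrightarrow> A x = t x *s x" by metis
  have nz: "x \<noteq> 0" if "x \<in> B" for x using B(1) that dependent_zero by blast
  have "inj_on t B"
  proof (rule inj_onI, rule ccontr)
    fix x y assume xy: "x \<in> B" "y \<in> B" "t x = t y" "x \<noteq> y"
    obtain e where "x = e *s y"
      using lower_bidiagonal_eigenspace[OF assms(1-3) t[OF xy(1)]] t[OF xy(2)] xy(3) nz[OF xy(2)] by auto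
    also have "e *s y \<in> span (B - {x})"
      using xy by (intro span_scale span_base) auto
    finally show False using B(1) xy(1) by (auto simp: dependent_def)
  qed
  moreover have "card B = Suc d"
    using dim_eq_card[of B UNIV] B(1,2) dim_UNIV_indexed_basis[OF assms(1)] by simp
  ultimately have "card (t ` B) = Suc d" by (simp add: card_image)
  moreover have "t ` B \<subseteq> \<theta> ` {..d}"
    using lower_bidiagonal_eigenvalue[OF assms(1-3) t nz] by blast
  ultimately have "Suc d \<le> card (\<theta> ` {..d})"
    using card_mono[of "\<theta> ` {..d}" "t ` B"] by simp
  then have "card (\<theta> ` {..d}) = card {..d}"
    using card_image_le[of "{..d}" \<theta>] by simp
  then show ?thesis by (intro eq_card_imp_inj_on) auto
qed

section \<open>Primitive idempotents and the flat part in coordinates\<close>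

lemma eigenbasis_eigenspace:
  assumes "indexed_basis scale d w" "Vector_Spaces.linear scale scale A"
    and "has_matrix d w A (tri_matrix (\<lambda>_. 0) \<theta> (\<lambda>_. 0))" "inj_on \<theta> {..d}" "j \<le> d" "A x = \<theta> j *s x"
  shows "x = representation (w ` {..d}) x (w j) *s w j"
proof -
  let ?c = "\<lambda>i. representation (w ` {..d}) x (w i)"
  have "?c i = 0" if "i \<le> d" "i \<noteq> j" for i
  proof -
    have "\<theta> i * ?c i = \<theta> j * ?c i"
      using eigenvector_coordinates[OF assms(1-3,6) that(1)]
      unfolding sum_tri_matrix_row[OF that(1)] by (simp cong: if_cong)
    then show ?thesis using assms(4,5) that by (auto simp: inj_on_eq_iff)
  qed
  then have "(\<Sum>i\<le>d. ?c i *s w i) = (\<Sum>i\<le>d. if i = j then ?c j *s w j else 0)"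
    by (intro sum.cong) auto
  then show ?thesis
    using indexed_basis_expand[OF assms(1), of x] assms(5) by simp
qed

lemma eigenbasis_eigenvalues:
  assumes "indexed_basis scale d w" "Vector_Spaces.linear scale scale A"
    and "has_matrix d w A (tri_matrix (\<lambda>_. 0) \<theta> (\<lambda>_. 0))"
  shows "eigenvalues scale A = \<theta> ` {..d}"
proof
  show "\<theta> ` {..d} \<subseteq> eigenvalues scale A"
    using has_matrix_tri_matrix_diagD[OF assms(3)] indexed_basis_nonzero[OF assms(1)]
    by (auto simp: eigenvalues_def)
  show "eigenvalues scale A \<subseteq> \<theta> ` {..d}"
  proof (rule ccontr)
    assume "\<not> eigenvalues scale A \<subseteq> \<theta> ` {..d}"
    then obtain t x where t: "t \<notin> \<theta> ` {..d}" "x \<noteq> 0" "A x = t *s x"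
      by (auto simp: eigenvalues_def)
    have "representation (w ` {..d}) x (w i) = 0" if i: "i \<le> d" for i
      using eigenvector_coordinates[OF assms t(3) i] t(1) i
      unfolding sum_tri_matrix_row[OF i] by (auto cong: if_cong)
    then show False using indexed_basis_eq_0[OF assms(1)] t(2) by blast
  qed
qed

text \<open>Resolves the definite description: the coordinate projection qualifies, and any
  competitor has prescribed values on the eigenvectors \<open>w i\<close>, which span.\<close>

lemma primitive_idempotent_eigenbasis:
  assumes "indexed_basis scale d w" "Vector_Spaces.linear scale scale A"
    and "has_matrix d w A (tri_matrix (\<lambda>_. 0) \<theta> (\<lambda>_. 0))" "inj_on \<theta> {..d}" "j \<le> d"
  shows "primitive_idempotent scale A (\<theta> j) = (\<lambda>x. representation (w ` {..d}) x (w j) *s w j)"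
  unfolding primitive_idempotent_def
proof (rule the_equality, intro conjI ballI)
  note b = indexed_basisD[OF assms(1)]
  let ?E = "\<lambda>x. representation (w ` {..d}) x (w j) *s w j"
  show lin: "Vector_Spaces.linear scale scale ?E"
    by (rule linear_endoI) (use b in \<open>auto simp: representation_add representation_scale scale_left_distrib\<close>)
  show "?E x = x" if "x \<in> eigenspace scale A (\<theta> j)" for x
    using eigenbasis_eigenspace[OF assms, of x] that by (auto simp: eigenspace_def)
  show "?E x = 0" if u: "u \<in> eigenvalues scale A - {\<theta> j}" and x: "x \<in> eigenspace scale A u" for u x
  proof -
    obtain i where i: "i \<le> d" "u = \<theta> i" "i \<noteq> j"
      using u eigenbasis_eigenvalues[OF assms(1-3)] by auto
    then obtain e where "x = e *s w i"
      using eigenbasis_eigenspace[OF assms(1-4) i(1), of x] x by (auto simp: eigenspace_def)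
    then show ?thesis
      using b i assms(5) by (auto simp: representation_scale representation_basis inj_on_eq_iff)
  qed
  fix E
  assume E: "Vector_Spaces.linear scale scale E \<and> (\<forall>v\<in>eigenspace scale A (\<theta> j). E v = v) \<and>
      (\<forall>u\<in>eigenvalues scale A - {\<theta> j}. \<forall>v\<in>eigenspace scale A u. E v = 0)"
  interpret E: Vector_Spaces.linear scale scale E using E by blast
  have w: "w i \<in> eigenspace scale A (\<theta> i)" if "i \<le> d" for i
    using has_matrix_tri_matrix_diagD[OF assms(3)] that by (simp add: eigenspace_def)
  have Ew: "E (w i) = (if i = j then w j else 0)" if "i \<le> d" for i
    using E w[OF that] that assms(4,5) eigenbasis_eigenvalues[OF assms(1-3)] by (auto simp: inj_on_eq_iff)
  show "E = ?E"
  proof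
    fix x
    let ?c = "\<lambda>i. representation (w ` {..d}) x (w i)"
    have "E x = E (\<Sum>i\<le>d. ?c i *s w i)" using indexed_basis_expand[OF assms(1), of x] by simp
    also have "\<dots> = (\<Sum>i\<le>d. ?c i *s E (w i))" by (simp add: E.sum E.scale)
    also have "\<dots> = (\<Sum>i\<le>d. if i = j then ?c j *s w j else 0)"
      by (rule sum.cong) (auto simp: Ew)
    finally show "E x = ?E x" using assms(5) by simp
  qed
qed

text \<open>Between two projections to the line of \<open>w i\<close> only the diagonal entry
  \<open>(i, i)\<close> of \<open>A\<close> survives. Distinct eigenvalues allow the sum over
  eigenvalues to be indexed by \<open>{..d}\<close>.\<close>

lemma flat_part_eigenbasis:
  assumes "indexed_basis scale d w" "Vector_Spaces.linear scale scale A" "Vector_Spaces.linear scale scale As"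
    and "has_matrix d w As (tri_matrix (\<lambda>_. 0) \<theta> (\<lambda>_. 0))" "inj_on \<theta> {..d}"
  shows "flat_part scale A As x = (\<Sum>i\<le>d. (matrix_of scale d w A i i * representation (w ` {..d}) x (w i)) *s w i)"
proof -
  note b = indexed_basisD[OF assms(1)]
  interpret A: Vector_Spaces.linear scale scale A by fact
  have "flat_part scale A As x
    = (\<Sum>i\<le>d. primitive_idempotent scale As (\<theta> i) (A (primitive_idempotent scale As (\<theta> i) x)))"
    unfolding flat_part_def eigenbasis_eigenvalues[OF assms(1,3,4)]
    by (subst sum.reindex) (use assms(5) in auto)
  also have "\<dots> = (\<Sum>i\<le>d. (matrix_of scale d w A i i * representation (w ` {..d}) x (w i)) *s w i)"
    using b by (intro sum.cong) (simp_all add: primitive_idempotent_eigenbasis[OF assms(1,3-5)] A.scale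
        representation_scale matrix_of_def mult.commute)
  finally show ?thesis .
qed

lemma linear_flat_part:
  assumes "indexed_basis scale d w" "Vector_Spaces.linear scale scale A" "Vector_Spaces.linear scale scale As"
    and "has_matrix d w As (tri_matrix (\<lambda>_. 0) \<theta> (\<lambda>_. 0))" "inj_on \<theta> {..d}"
  shows "Vector_Spaces.linear scale scale (flat_part scale A As)"
  using indexed_basisD[OF assms(1)]
  by (intro linear_endoI)
    (simp_all add: flat_part_eigenbasis[OF assms] representation_add representation_scale
      scale_sum_right sum.distrib[symmetric] scale_left_distrib distrib_left mult_ac)

lemma has_matrix_minus_flat_part:
  assumes "indexed_basis scale d w" "Vector_Spaces.linear scale scale A" "Vector_Spaces.linear scale scale As"
    and "has_matrix d w As (tri_matrix (\<lambda>_. 0) \<theta> (\<lambda>_. 0))" "inj_on \<theta> {..d}"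
    and "has_matrix d w A (tri_matrix l a u)"
  shows "has_matrix d w (A - flat_part scale A As) (tri_matrix l (\<lambda>_. 0) u)"
  unfolding has_matrix_def
proof (intro allI impI)
  note b = indexed_basisD[OF assms(1)]
  fix j assume j: "j \<le> d"
  have "flat_part scale A As (w j) = (\<Sum>i\<le>d. (if i = j then a j else 0) *s w i)"
    unfolding flat_part_eigenbasis[OF assms(1-5)]
    using b j by (intro sum.cong refl)
      (auto simp: representation_basis inj_on_eq_iff matrix_of_eqI[OF assms(1,6)] tri_matrix_def)
  moreover have "A (w j) = (\<Sum>i\<le>d. tri_matrix l a u i j *s w i)"
    using assms(6) j by (simp add: has_matrix_def)
  ultimately show "(A - flat_part scale A As) (w j) = (\<Sum>i\<le>d. tri_matrix l (\<lambda>_. 0) u i j *s w i)"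
    by (auto simp: sum_subtractf[symmetric] scale_left_diff_distrib[symmetric] tri_matrix_def intro!: sum.cong)
qed

end

section \<open>Leonard pairs from split bases\<close>

context scalar_space
begin

text \<open>Eigenspaces are lines, so \<open>u' i\<close> is a nonzero multiple of
  \<open>u i\<close>. Hence the vanishing of an entry of \<open>As\<close> does not depend on the
  choice of the eigenbasis of \<open>A\<close>.\<close>

lemma eigenbasis_rescale:
  assumes "indexed_basis scale d u" "indexed_basis scale d u'"
    and "Vector_Spaces.linear scale scale A" "Vector_Spaces.linear scale scale As"
    and "has_matrix d u A (tri_matrix (\<lambda>_. 0) \<theta> (\<lambda>_. 0))" "has_matrix d u' A (tri_matrix (\<lambda>_. 0) \<theta> (\<lambda>_. 0))"
    and "inj_on \<theta> {..d}"
  obtains e where "\<And>i. i \<le> d \<Longrightarrow> e i \<noteq> 0"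
    "\<And>i j. i \<le> d \<Longrightarrow> j \<le> d \<Longrightarrow> matrix_of scale d u' As j i * e j = e i * matrix_of scale d u As j i"
proof -
  interpret As: Vector_Spaces.linear scale scale As by fact
  define e where "e i = representation (u ` {..d}) (u' i) (u i)" for i
  have u': "u' i = e i *s u i" if "i \<le> d" for i
    unfolding e_def
    by (rule eigenbasis_eigenspace[OF assms(1,3,5,7) that has_matrix_tri_matrix_diagD[OF assms(6) that]])
  show ?thesis
  proof (rule that)
    show "e i \<noteq> 0" if "i \<le> d" for i
      using indexed_basis_nonzero[OF assms(2) that] u'[OF that] by auto
    show "matrix_of scale d u' As j i * e j = e i * matrix_of scale d u As j i" if ij: "i \<le> d" "j \<le> d" for i j
    proof -
      have "(\<Sum>j\<le>d. (matrix_of scale d u' As j i * e j) *s u j) = (\<Sum>j\<le>d. matrix_of scale d u' As j i *s u' j)"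
        by (simp add: u')
      also have "\<dots> = As (u' i)"
        using has_matrix_matrix_of[OF assms(2), of As] ij by (simp add: has_matrix_def)
      also have "\<dots> = (\<Sum>j\<le>d. (e i * matrix_of scale d u As j i) *s u j)"
        using has_matrix_matrix_of[OF assms(1), of As] ij by (simp add: has_matrix_def u' As.scale scale_sum_right)
      finally show ?thesis
        by (rule indexed_basis_coeff_eq[OF assms(1) _ ij(2)])
    qed
  qed
qed

text \<open>A lower unitriangular matrix \<open>R\<close> diagonalizes \<open>A\<close>. If
  \<open>U\<close> and \<open>H\<close> are the matrices of \<open>As\<close> in the two bases,
  \<open>U R = R H\<close> with \<open>U\<close> upper bidiagonal determines \<open>H\<close> above
  the diagonal.\<close>

lemma split_basis_hessenberg:
  assumes v: "indexed_basis scale d v"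
    and A: "Vector_Spaces.linear scale scale A" "has_matrix d v A (tri_matrix (\<lambda>_. 1) \<theta> (\<lambda>_. 0))"
    and As: "Vector_Spaces.linear scale scale As" "has_matrix d v As (tri_matrix (\<lambda>_. 0) \<theta>s \<phi>)"
    and inj: "inj_on \<theta> {..d}"
  obtains u where "indexed_basis scale d u" "has_matrix d u A (tri_matrix (\<lambda>_. 0) \<theta> (\<lambda>_. 0))"
    "\<And>i j. j < i \<Longrightarrow> i \<le> d \<Longrightarrow> matrix_of scale d u As j i = (if Suc j = i then \<phi> i else 0)"
proof -
  \<comment> \<open>Column \<open>i\<close> is the eigenvector for \<open>\<theta> i\<close>,
    obtained from \<open>R i i = 1\<close> by the recursion
    \<open>R k i = R (k - 1) i / (\<theta> i - \<theta> k)\<close>.\<close>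
  define R where "R k i = (if i \<le> k then \<Prod>m\<in>{i<..k}. inverse (\<theta> i - \<theta> m) else 0)" for k i
  have R1: "R i i = 1" for i by (simp add: R_def)
  have R0: "R k i = 0" if "k < i" for k i using that by (simp add: R_def)
  have R: "\<theta> k * R k i + (if 0 < k then R (k - 1) i else 0) = R k i * \<theta> i" if "k \<le> d" "i \<le> d" for k i
  proof (cases "i < k")
    case True
    then obtain k' where k: "k = Suc k'" "i \<le> k'" by (cases k) auto
    then have "{i<..k} = insert k {i<..k'}" by auto
    then have "R k i = inverse (\<theta> i - \<theta> k) * R k' i" using k by (simp add: R_def)
    moreover have "\<theta> i - \<theta> k \<noteq> 0" using inj that True by (auto simp: inj_on_eq_iff)
    ultimately show ?thesis using k by (simp add: field_simps)
  qed (use R0 that in \<open>auto simp: not_less le_eq_less_or_eq\<close>)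
  define u where "u j = (\<Sum>i\<le>d. R i j *s v i)" for j
  have ub: "indexed_basis scale d u"
    by (rule unitriangular_matrix_indexed_basis[OF v u_def, where f = "\<lambda>i. d - i"])
      (auto simp: R1 intro!: R0)
  have uA: "has_matrix d u A (tri_matrix (\<lambda>_. 0) \<theta> (\<lambda>_. 0))"
    by (rule has_matrix_change_basis[OF A u_def])
      (use R in \<open>simp add: sum_tri_matrix_row sum_tri_matrix_col cong: if_cong\<close>)
  have "matrix_of scale d u As j i = (if Suc j = i then \<phi> i else 0)" if ij: "j < i" "i \<le> d" for i j
  proof -
    let ?H = "matrix_of scale d u As"
    have "(\<Sum>k\<le>d. (\<Sum>l\<le>d. tri_matrix (\<lambda>_. 0) \<theta>s \<phi> k l * R l i) *s v k) = As (u i)"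
      by (simp add: u_def has_matrix_apply[OF As])
    also have "\<dots> = (\<Sum>l\<le>d. ?H l i *s u l)"
      using has_matrix_matrix_of[OF ub, of As] ij by (simp add: has_matrix_def)
    also have "\<dots> = (\<Sum>k\<le>d. (\<Sum>l\<le>d. R k l * ?H l i) *s v k)"
      unfolding u_def scale_sum_right scale_sum_left by (subst sum.swap) (simp add: mult.commute)
    finally have UR: "(\<Sum>l\<le>d. tri_matrix (\<lambda>_. 0) \<theta>s \<phi> k l * R l i) = (\<Sum>l\<le>d. R k l * ?H l i)" if "k \<le> d" for k
      by (rule indexed_basis_coeff_eq[OF v _ that])
    \<comment> \<open>In row \<open>j\<close> of \<open>R H\<close> the terms before
      \<open>j\<close> vanish by induction and those after \<open>j\<close> because \<open>R\<close>
      is lower triangular. In the same row of \<open>U R\<close> only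
      \<open>\<phi> (Suc j) * R (Suc j) i\<close> is left, which is 0 unless
      \<open>Suc j = i\<close>.\<close>
    show ?thesis using ij(1)
    proof (induction j rule: less_induct)
      case (less j)
      then have jd: "j < d" using ij by simp
      have "(\<Sum>l\<le>d. R j l * ?H l i) = (\<Sum>l\<le>d. if l = j then ?H j i else 0)"
      proof (rule sum.cong)
        fix l assume "l \<in> {..d}"
        have "?H l i = 0" if "l < j" using less.IH[OF that] that less.prems by simp
        then show "R j l * ?H l i = (if l = j then ?H j i else 0)"
          by (cases l j rule: linorder_cases) (simp_all add: R1 R0)
      qed simp
      also have "\<dots> = ?H j i" using jd by simp
      finally have "?H j i = (\<Sum>l\<le>d. tri_matrix (\<lambda>_. 0) \<theta>s \<phi> j l * R l i)"
        using UR[of j] jd by simp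
      also have "\<dots> = \<phi> (Suc j) * R (Suc j) i"
        using jd less.prems by (simp add: sum_tri_matrix_row R0)
      finally show ?case using less.prems by (auto simp: R1 R0)
    qed
  qed
  then show ?thesis using that ub uA by blast
qed

text \<open>By \<open>split_basis_hessenberg\<close> the scalar \<open>\<phi> i\<close> is the entry
  \<open>(i - 1, i)\<close> of \<open>As\<close> in some eigenbasis of \<open>A\<close>, and
  \<open>eigenbasis_rescale\<close> compares it with the nonzero entry in the basis
  \<open>u\<close>.\<close>

lemma split_sequence_nonzero:
  assumes "indexed_basis scale d v"
    and "Vector_Spaces.linear scale scale A" "has_matrix d v A (tri_matrix (\<lambda>_. 1) \<theta> (\<lambda>_. 0))"
    and "Vector_Spaces.linear scale scale As" "has_matrix d v As (tri_matrix (\<lambda>_. 0) \<theta>s \<phi>)"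
    and "inj_on \<theta> {..d}"
    and "indexed_basis scale d u" "has_matrix d u A (tri_matrix (\<lambda>_. 0) \<theta> (\<lambda>_. 0))"
    and "irreducible_tridiagonal d (matrix_of scale d u As)"
    and "i \<in> {1..d}"
  shows "\<phi> i \<noteq> 0"
proof -
  obtain u' where u': "indexed_basis scale d u'" "has_matrix d u' A (tri_matrix (\<lambda>_. 0) \<theta> (\<lambda>_. 0))"
    "\<And>i j. j < i \<Longrightarrow> i \<le> d \<Longrightarrow> matrix_of scale d u' As j i = (if Suc j = i then \<phi> i else 0)"
    using split_basis_hessenberg[OF assms(1-6)] by blast
  obtain e where e: "\<And>i. i \<le> d \<Longrightarrow> e i \<noteq> 0"
    "\<And>i j. i \<le> d \<Longrightarrow> j \<le> d \<Longrightarrow> matrix_of scale d u' As j i * e j = e i * matrix_of scale d u As j i"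
    using eigenbasis_rescale[OF assms(7) u'(1) assms(2,4,8) u'(2) assms(6)] by blast
  obtain j where j: "i = Suc j" "j < d" using assms(10) by (cases i) auto
  then have "matrix_of scale d u As j i \<noteq> 0"
    using assms(9)[unfolded irreducible_tridiagonal_def, rule_format, of j i] by auto
  then show ?thesis using e(2)[of i j] e(1)[of i] u'(3)[of j i] j by auto
qed

text \<open>In the eigenbasis of \<open>A\<close> the first split form bounds \<open>As\<close> on one side of the diagonal
  and the second split form, in which the eigenvalues are reversed, on the other side.\<close>

lemma irreducible_tridiagonal_of_split_bases:
  assumes A: "Vector_Spaces.linear scale scale A" and As: "Vector_Spaces.linear scale scale As"
    and inj: "inj_on \<theta> {..d}"
    and v: "indexed_basis scale d v" "has_matrix d v A (tri_matrix (\<lambda>_. 1) \<theta> (\<lambda>_. 0))"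
      "has_matrix d v As (tri_matrix (\<lambda>_. 0) \<theta>s \<phi>1)" "\<And>i. i \<in> {1..d} \<Longrightarrow> \<phi>1 i \<noteq> 0"
    and v': "indexed_basis scale d v'" "has_matrix d v' A (tri_matrix (\<lambda>_. 1) (\<lambda>i. \<theta> (d - i)) (\<lambda>_. 0))"
      "has_matrix d v' As (tri_matrix (\<lambda>_. 0) \<theta>s \<phi>2)" "\<And>i. i \<in> {1..d} \<Longrightarrow> \<phi>2 i \<noteq> 0"
  obtains u where "indexed_basis scale d u" "has_matrix d u A (tri_matrix (\<lambda>_. 0) \<theta> (\<lambda>_. 0))"
    "irreducible_tridiagonal d (matrix_of scale d u As)"
proof -
  have inj': "inj_on (\<lambda>i. \<theta> (d - i)) {..d}"
    by (rule inj_onI) (use inj in \<open>auto dest!: inj_onD\<close>)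
  obtain u where u: "indexed_basis scale d u" "has_matrix d u A (tri_matrix (\<lambda>_. 0) \<theta> (\<lambda>_. 0))"
    "\<And>i j. j < i \<Longrightarrow> i \<le> d \<Longrightarrow> matrix_of scale d u As j i = (if Suc j = i then \<phi>1 i else 0)"
    using split_basis_hessenberg[OF v(1) A v(2) As v(3) inj] by blast
  obtain u' where u': "indexed_basis scale d u'" "has_matrix d u' A (tri_matrix (\<lambda>_. 0) (\<lambda>i. \<theta> (d - i)) (\<lambda>_. 0))"
    "\<And>i j. j < i \<Longrightarrow> i \<le> d \<Longrightarrow> matrix_of scale d u' As j i = (if Suc j = i then \<phi>2 i else 0)"
    using split_basis_hessenberg[OF v'(1) A v'(2) As v'(3) inj'] by blast
  \<comment> \<open>Reversing \<open>u\<close> puts the eigenvalues in the order of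
    \<open>u'\<close>, so that the two eigenbases can be compared entrywise.\<close>
  define ur where "ur i = u (d - i)" for i
  have ur: "indexed_basis scale d ur" unfolding ur_def by (rule indexed_basis_reverse[OF u(1)])
  have urM: "matrix_of scale d ur B j i = matrix_of scale d u B (d - j) (d - i)" for B i j
    unfolding ur_def by (rule matrix_of_reverse)
  have urA: "has_matrix d ur A (tri_matrix (\<lambda>_. 0) (\<lambda>i. \<theta> (d - i)) (\<lambda>_. 0))"
    using u(2) by (simp add: has_matrix_tri_matrix_diag_iff ur_def)
  obtain e where e: "\<And>i. i \<le> d \<Longrightarrow> e i \<noteq> 0"
    "\<And>i j. i \<le> d \<Longrightarrow> j \<le> d \<Longrightarrow> matrix_of scale d u' As j i * e j = e i * matrix_of scale d ur As j i"
    using eigenbasis_rescale[OF ur u'(1) A As urA u'(2) inj'] by blast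
  \<comment> \<open>Reversal carries the entries of \<open>u'\<close> above the diagonal to those of
    \<open>u\<close> below it, so this settles the side of \<open>u\<close> that the first split
    form leaves open.\<close>
  have upper: "matrix_of scale d u As j i = 0 \<longleftrightarrow> Suc i \<noteq> j" if ij: "i < j" "j \<le> d" for i j
  proof -
    have "matrix_of scale d ur As (d - j) (d - i) = matrix_of scale d u As j i"
      using urM[of As "d - j" "d - i"] ij by simp
    then have "matrix_of scale d u As j i = 0 \<longleftrightarrow> matrix_of scale d u' As (d - j) (d - i) = 0"
      using e(2)[of "d - i" "d - j"] e(1)[of "d - i"] e(1)[of "d - j"] by auto
    also have "\<dots> \<longleftrightarrow> Suc i \<noteq> j"
      using u'(3)[of "d - j" "d - i"] ij v'(4)[of "d - i"] by auto
    finally show ?thesis .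
  qed
  have "irreducible_tridiagonal d (matrix_of scale d u As)"
    unfolding irreducible_tridiagonal_def
  proof (intro allI impI conjI)
    fix i j assume "i \<le> d" "j \<le> d"
    then show "Suc j < i \<or> Suc i < j \<Longrightarrow> matrix_of scale d u As i j = 0"
      and "i = Suc j \<or> j = Suc i \<Longrightarrow> matrix_of scale d u As i j \<noteq> 0"
      using upper[of j i] u(3)[of i j] v(4)[of j] by auto
  qed
  then show ?thesis using that u(1,2) by blast
qed

end

section \<open>The bipartite contraction\<close>

lemma krawtchouk_split_nonzero:
  assumes "r \<noteq> 0" "\<And>k. k \<in> {1..d} \<Longrightarrow> r ^ k \<noteq> 1" "a \<noteq> 0" "i \<in> {1..d}"
  shows "krawtchouk_split d r a i \<noteq> (0::'a::field)"
proof -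
  have "r ^ Suc d = r ^ i * r ^ (Suc d - i)"
    using assms(4) by (simp flip: power_add)
  moreover have "r ^ (Suc d - i) \<noteq> 1" using assms(4) by (intro assms(2)) auto
  ultimately have "r ^ i - r ^ Suc d \<noteq> 0" using assms(1) by simp
  then show ?thesis using assms by (simp add: krawtchouk_split_def)
qed

text \<open>With \<open>b = - (a * r ^ d)\<close> the values at \<open>i\<close> and
  \<open>j\<close> differ by \<open>a (r ^ i - r ^ j) (r ^ (i + j) + r ^ d) / r ^ (i + j)\<close>.
  For \<open>i < j\<close> a collision thus means that \<open>r\<close> to the power
  \<open>|i + j - d|\<close> is -1. This exponent is at most \<open>d - 1\<close>, and 0 is excluded
  by \<open>1 \<noteq> -1\<close>.\<close>

lemma bipartite_eigenvalues_inj_iff: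
  fixes r a b :: "'a::field"
  assumes r: "r \<noteq> 0" "\<And>k. k \<in> {1..d} \<Longrightarrow> r ^ k \<noteq> 1" and a: "a \<noteq> 0" "a * r ^ d + b = 0"
    and char: "(1::'a) \<noteq> -1"
  shows "inj_on (\<lambda>i. a * r ^ i + b / r ^ i) {..d} \<longleftrightarrow> (\<forall>k\<in>{1..d-1}. r ^ k \<noteq> -1)"
proof
  have b: "b = - (a * r ^ d)" using a(2) by (simp add: eq_neg_iff_add_eq_0 add.commute)
  show "\<forall>k\<in>{1..d-1}. r ^ k \<noteq> -1" if inj: "inj_on (\<lambda>i. a * r ^ i + b / r ^ i) {..d}"
  proof (intro ballI notI)
    \<comment> \<open>The exponent \<open>k\<close> is realised by the pair of indices
      \<open>k\<close> and \<open>d\<close>.\<close>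
    fix k assume k: "k \<in> {1..d-1}" "r ^ k = -1"
    then have "a * r ^ d + b / r ^ d = a * r ^ k + b / r ^ k" using r(1) by (simp add: b)
    moreover have "d \<in> {..d}" "k \<in> {..d}" using k by auto
    ultimately have "d = k" by (rule inj_onD[OF inj])
    then show False using k by auto
  qed
  show "inj_on (\<lambda>i. a * r ^ i + b / r ^ i) {..d}" if r': "\<forall>k\<in>{1..d-1}. r ^ k \<noteq> -1"
  proof (rule linorder_inj_onI)
    fix i j assume ij: "i < j" "i \<in> {..d}" "j \<in> {..d}"
    show "a * r ^ i + b / r ^ i \<noteq> a * r ^ j + b / r ^ j"
    proof
      assume e: "a * r ^ i + b / r ^ i = a * r ^ j + b / r ^ j"
      have "a * ((r ^ i - r ^ j) * (r ^ i * r ^ j + r ^ d))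
        = (a * r ^ i + b / r ^ i) * (r ^ i * r ^ j) - (a * r ^ j + b / r ^ j) * (r ^ i * r ^ j)"
        using r(1) by (simp add: b algebra_simps)
      also have "\<dots> = 0" by (simp add: e)
      finally have "a * ((r ^ i - r ^ j) * (r ^ i * r ^ j + r ^ d)) = 0" .
      moreover have "r ^ i \<noteq> r ^ j"
      proof
        assume "r ^ i = r ^ j"
        moreover have "r ^ j = r ^ i * r ^ (j - i)" using ij by (simp flip: power_add)
        moreover have "r ^ (j - i) \<noteq> 1" using ij by (intro r(2)) auto
        ultimately show False using r(1) by simp
      qed
      ultimately have e: "r ^ (i + j) = - (r ^ d)" using a(1) by (simp add: power_add eq_neg_iff_add_eq_0)
      consider "i + j = d" | "i + j < d" | "d < i + j" by linarith
      then show False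
      proof cases
        case 1
        then have "r ^ d * 1 = r ^ d * (-1)" using e by simp
        then show ?thesis using r(1) char by (metis mult_cancel_left power_not_zero)
      next
        case 2
        then have "r ^ d = r ^ (i + j) * r ^ (d - (i + j))" by (simp flip: power_add)
        then have "r ^ (i + j) * 1 = r ^ (i + j) * (- (r ^ (d - (i + j))))" using e by simp
        then have "1 = - (r ^ (d - (i + j)))" using r(1) by (metis mult_cancel_left power_not_zero)
        then have "r ^ (d - (i + j)) = -1" by (simp add: minus_equation_iff)
        moreover have "d - (i + j) \<in> {1..d-1}" using 2 ij by auto
        ultimately show ?thesis using r' by blast
      next
        case 3
        then have "r ^ (i + j) = r ^ d * r ^ (i + j - d)" by (simp flip: power_add)
        then have "r ^ d * r ^ (i + j - d) = r ^ d * (-1)" using e by simp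
        then have "r ^ (i + j - d) = -1" using r(1) by (metis mult_cancel_left power_not_zero)
        moreover have "i + j - d \<in> {1..d-1}" using 3 ij by auto
        ultimately show ?thesis using r' by blast
      qed
    qed
  qed auto
qed

context scalar_space
begin

lemma diagonal_upto_of_has_matrix:
  "indexed_basis scale d v \<Longrightarrow> has_matrix d v A (tri_matrix (\<lambda>_. 0) \<theta> (\<lambda>_. 0))
    \<Longrightarrow> diagonal_upto d (matrix_of scale d v A)"
  by (simp add: diagonal_upto_def matrix_of_eqI tri_matrix_def)

lemma near_bipartite_imp_diagonalizable:
  assumes "near_bipartite scale d A As"
  shows "diagonalizable scale (A - flat_part scale A As)"
proof -
  let ?A = "A - flat_part scale A As"
  obtain v where v: "indexed_basis scale d v" "diagonal_upto d (matrix_of scale d v ?A)"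
    using assms by (auto simp: near_bipartite_def leonard_pair_def)
  have "has_matrix d v ?A (tri_matrix (\<lambda>_. 0) (\<lambda>i. matrix_of scale d v ?A i i) (\<lambda>_. 0))"
    unfolding has_matrix_iff[OF v(1)] using v(2) by (auto simp: tri_matrix_def diagonal_upto_def)
  then have "\<forall>x\<in>v ` {..d}. \<exists>t. ?A x = t *s x"
    by (auto simp: has_matrix_tri_matrix_diag_iff)
  then show ?thesis
    using indexed_basisD[OF v(1)] unfolding diagonalizable_def by blast
qed

text \<open>The split bases for \<open>(a, b)\<close> and for the mirror pair
  \<open>(b / r ^ d, a * r ^ d)\<close> come from the same eigenbasis \<open>w\<close>. Together
  they make \<open>As\<close> irreducible tridiagonal in an eigenbasis of \<open>A\<close>, while
  \<open>w\<close> itself supplies the other half of the Leonard pair.\<close>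

lemma krawtchouk_parameter_array:
  fixes a b m :: 'a
  assumes r: "r \<noteq> 0" "\<And>k. k \<in> {1..d} \<Longrightarrow> r ^ k \<noteq> 1" and ab: "a \<noteq> 0" "b \<noteq> 0" and m: "m \<noteq> 0"
    and A: "Vector_Spaces.linear scale scale A" and As: "Vector_Spaces.linear scale scale As"
    and w: "indexed_basis scale d w"
      "has_matrix d w A (tri_matrix (\<lambda>_. 1) (\<lambda>i. \<delta> + (a * r ^ d + b) / r ^ i) (krawtchouk_offdiag d r (a * b)))"
      "has_matrix d w As (tri_matrix (\<lambda>_. 0) (\<lambda>i. \<delta>s + m * r ^ i) (\<lambda>_. 0))"
    and inj: "inj_on (\<lambda>i. \<delta> + a * r ^ i + b / r ^ i) {..d}"
    and injs: "inj_on (\<lambda>i. \<delta>s + m * r ^ i) {..d}"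
  shows "parameter_array scale d A As (\<lambda>i. \<delta> + a * r ^ i + b / r ^ i) (\<lambda>i. \<delta>s + m * r ^ i)
    (\<lambda>i. m * krawtchouk_split d r a i) (\<lambda>i. m * krawtchouk_split d r (b / r ^ d) i)"
proof -
  let ?\<theta> = "\<lambda>i. \<delta> + a * r ^ i + b / r ^ i"
  obtain v where v: "indexed_basis scale d v"
    "has_matrix d v A (tri_matrix (\<lambda>_. 1) ?\<theta> (\<lambda>_. 0))"
    "has_matrix d v As (tri_matrix (\<lambda>_. 0) (\<lambda>i. \<delta>s + m * r ^ i) (\<lambda>i. m * krawtchouk_split d r a i))"
    using krawtchouk_split_of_eigenbasis[OF r w(1) A As w(2,3)] by blast
  have sym: "b / r ^ d * r ^ d + a * r ^ d = a * r ^ d + b" "b / r ^ d * (a * r ^ d) = a * b"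
    using r(1) by simp_all
  obtain v' where v': "indexed_basis scale d v'"
    "has_matrix d v' A (tri_matrix (\<lambda>_. 1) (\<lambda>i. \<delta> + b / r ^ d * r ^ i + a * r ^ d / r ^ i) (\<lambda>_. 0))"
    "has_matrix d v' As (tri_matrix (\<lambda>_. 0) (\<lambda>i. \<delta>s + m * r ^ i) (\<lambda>i. m * krawtchouk_split d r (b / r ^ d) i))"
    using krawtchouk_split_of_eigenbasis[OF r w(1) A As, of \<delta> "b / r ^ d" "a * r ^ d" \<delta>s m] w(2,3)
    unfolding sym by blast
  \<comment> \<open>The mirror pair lists the eigenvalues backwards, as the second split form
    demands.\<close>
  have rev: "\<delta> + b / r ^ d * r ^ i + a * r ^ d / r ^ i = ?\<theta> (d - i)" if "i \<le> d" for i
  proof -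
    have "r ^ d = r ^ i * r ^ (d - i)" using that by (simp flip: power_add)
    then show ?thesis using r(1) by (simp add: field_simps)
  qed
  have v'A: "has_matrix d v' A (tri_matrix (\<lambda>_. 1) (\<lambda>i. ?\<theta> (d - i)) (\<lambda>_. 0))"
    using v'(2) by (rule iffD1[OF has_matrix_cong, rotated]) (simp only: tri_matrix_def rev)
  obtain u where u: "indexed_basis scale d u" "has_matrix d u A (tri_matrix (\<lambda>_. 0) ?\<theta> (\<lambda>_. 0))"
    "irreducible_tridiagonal d (matrix_of scale d u As)"
    by (rule irreducible_tridiagonal_of_split_bases[OF A As inj v _ v'(1) v'A v'(3)])
      (use krawtchouk_split_nonzero[OF r] ab m r(1) in auto)
  have offdiag: "krawtchouk_offdiag d r (a * b) i \<noteq> 0" if "i \<in> {1..d}" for i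
    using krawtchouk_split_nonzero[OF r ab(1) that] ab r(1) by (simp add: krawtchouk_offdiag_eq_split)
  have wA: "irreducible_tridiagonal d (matrix_of scale d w A)"
    unfolding irreducible_tridiagonal_def
    by (auto simp: matrix_of_eqI[OF w(1,2)] tri_matrix_def offdiag)
  have "leonard_pair scale d A As"
    unfolding leonard_pair_def
    using dim_UNIV_indexed_basis[OF w(1)] A As w wA u diagonal_upto_of_has_matrix by auto
  moreover have "standard_ordering scale d A As ?\<theta>"
    unfolding standard_ordering_def
    using u inj eigenbasis_eigenvalues[OF u(1) A u(2)] diagonal_with_iff_has_matrix[OF u(1)]
    by (auto intro!: inj_on_imp_bij_betw)
  moreover have "standard_ordering scale d As A (\<lambda>i. \<delta>s + m * r ^ i)"
    unfolding standard_ordering_def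
    using w wA injs eigenbasis_eigenvalues[OF w(1) As w(3)] diagonal_with_iff_has_matrix[OF w(1)]
    by (auto intro!: inj_on_imp_bij_betw)
  ultimately show ?thesis
    unfolding parameter_array_def
    using v v'(1,3) v'A lower_bidiagonal_iff_has_matrix upper_bidiagonal_iff_has_matrix by blast
qed

text \<open>Near-bipartiteness, diagonalizability, the condition on powers of \<open>r\<close> and
  the parameter array form a cycle of implications; multiplicity-freeness joins it through the
  bidiagonal form of \<open>A'\<close>.\<close>

lemma krawtchouk_bipartite_contraction:
  fixes a b m a' b' :: 'a
  assumes r: "r \<noteq> 0" "\<And>k. k \<in> {1..d} \<Longrightarrow> r ^ k \<noteq> 1" and ab: "a \<noteq> 0" "b \<noteq> 0" and m: "m \<noteq> 0"
    and char: "(1::'a) \<noteq> -1"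
    and L: "leonard_pair scale d A As"
    and v: "indexed_basis scale d v"
      "has_matrix d v A (tri_matrix (\<lambda>_. 1) (\<lambda>i. \<delta> + a * r ^ i + b / r ^ i) (\<lambda>_. 0))"
      "has_matrix d v As (tri_matrix (\<lambda>_. 0) (\<lambda>i. \<delta>s + m * r ^ i) (\<lambda>i. m * krawtchouk_split d r a i))"
    and injs: "inj_on (\<lambda>i. \<delta>s + m * r ^ i) {..d}"
    and ab': "a' * b' = a * b" "a' * r ^ d + b' = 0"
  defines "A' \<equiv> A - flat_part scale A As"
  shows "(near_bipartite scale d A As \<longleftrightarrow> diagonalizable scale A') \<and>
    (diagonalizable scale A' \<longleftrightarrow> multiplicity_free scale A') \<and>
    (multiplicity_free scale A' \<longleftrightarrow> (\<forall>k\<in>{1..d-1}. r ^ k \<noteq> -1)) \<and>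
    (near_bipartite scale d A As \<longrightarrow>
      parameter_array scale d A' As (\<lambda>i. a' * r ^ i + b' / r ^ i) (\<lambda>i. \<delta>s + m * r ^ i)
        (\<lambda>i. m * krawtchouk_split d r a' i) (\<lambda>i. m * krawtchouk_split d r (b' / r ^ d) i))"
    (is "_ \<and> _ \<and> _ \<and> (_ \<longrightarrow> ?PA)")
proof -
  have A: "Vector_Spaces.linear scale scale A" and As: "Vector_Spaces.linear scale scale As"
    using L by (auto simp: leonard_pair_def)
  obtain w where w: "indexed_basis scale d w"
    "has_matrix d w A (tri_matrix (\<lambda>_. 1) (\<lambda>i. \<delta> + (a * r ^ d + b) / r ^ i) (krawtchouk_offdiag d r (a * b)))"
    "has_matrix d w As (tri_matrix (\<lambda>_. 0) (\<lambda>i. \<delta>s + m * r ^ i) (\<lambda>_. 0))"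
    using krawtchouk_eigenbasis_of_split[OF r v(1) A As v(2,3)] by blast
  have A': "Vector_Spaces.linear scale scale A'"
    unfolding A'_def by (intro linear_endo_diff A linear_flat_part[OF w(1) A As w(3) injs])
  have "has_matrix d w A' (tri_matrix (\<lambda>_. 1) (\<lambda>_. 0) (krawtchouk_offdiag d r (a * b)))"
    unfolding A'_def by (rule has_matrix_minus_flat_part[OF w(1) A As w(3) injs w(2)])
  \<comment> \<open>The erased diagonal is rewritten as
    \<open>0 + (a' * r ^ d + b') / r ^ i\<close>, which gives \<open>A'\<close> the shape of
    \<open>A\<close> with \<open>\<delta> = 0\<close>.\<close>
  then have wA': "has_matrix d w A' (tri_matrix (\<lambda>_. 1) (\<lambda>i. 0 + (a' * r ^ d + b') / r ^ i) (krawtchouk_offdiag d r (a' * b')))"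
    by (simp add: ab')
  have nz: "a' \<noteq> 0" "b' \<noteq> 0" using ab ab'(1) by auto
  obtain v' where v': "indexed_basis scale d v'"
    "has_matrix d v' A' (tri_matrix (\<lambda>_. 1) (\<lambda>i. 0 + a' * r ^ i + b' / r ^ i) (\<lambda>_. 0))"
    using krawtchouk_split_of_eigenbasis[OF r w(1) A' As wA' w(3)] by blast
  note inj_iff = bipartite_eigenvalues_inj_iff[OF r nz(1) ab'(2) char]
  have mf: "multiplicity_free scale A' \<longleftrightarrow> diagonalizable scale A'"
    by (rule lower_bidiagonal_multiplicity_free_iff[OF v'(1) A' v'(2)])
  have "\<forall>k\<in>{1..d-1}. r ^ k \<noteq> -1" if "diagonalizable scale A'"
    using lower_bidiagonal_diagonalizable_imp_inj[OF v'(1) A' v'(2) that] inj_iff by simp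
  moreover have "?PA" if "\<forall>k\<in>{1..d-1}. r ^ k \<noteq> -1"
    using krawtchouk_parameter_array[OF r nz m A' As w(1) wA' w(3) _ injs] that inj_iff by simp
  moreover have "near_bipartite scale d A As" if ?PA
    using that L by (simp add: near_bipartite_def parameter_array_def A'_def)
  moreover have "diagonalizable scale A'" if "near_bipartite scale d A As"
    using near_bipartite_imp_diagonalizable[OF that] by (simp add: A'_def)
  ultimately show ?thesis using mf by blast
qed

end

section \<open>Reduction to the dual q-Krawtchouk parameters\<close>

lemma powi_two_minus:
  fixes q :: "'a::field"
  assumes "q \<noteq> 0"
  shows "q powi (2 * int i - int d) = q powi (- int d) * (q\<^sup>2) ^ i"
proof -
  have "2 * int i - int d = - int d + int (2 * i)" by simp
  then show ?thesis using assms by (simp only: power_int_add power_int_of_nat power_mult simp_thms)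
qed

lemma powi_minus_two:
  fixes q :: "'a::field"
  assumes "q \<noteq> 0"
  shows "q powi (int d - 2 * int i) = q ^ d / (q\<^sup>2) ^ i"
proof -
  have "int d - 2 * int i = int d - int (2 * i)" by simp
  then show ?thesis using assms by (simp only: power_int_diff power_int_of_nat power_mult simp_thms)
qed

lemma split_factor_eq:
  fixes q :: "'a::field"
  assumes "q \<noteq> 0"
  shows "split_factor d q i * q powi (2 * int i - int d - 1)
    = - (q powi (- int d) * q powi (- int d) / q\<^sup>2 * ((q\<^sup>2) ^ i - 1) * ((q\<^sup>2) ^ i - (q\<^sup>2) ^ Suc d))"
proof -
  \<comment> \<open>All integer powers of \<open>q\<close> that occur are monomials in
    \<open>x\<close>, \<open>y\<close>, \<open>q\<close> and their inverses, which reduces the claim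
    to field arithmetic.\<close>
  define x y where "x = q ^ i" and "y = q ^ d"
  have nz: "x \<noteq> 0" "y \<noteq> 0" using assms by (simp_all add: x_def y_def)
  have e: "int d - int i + 1 = int d - int i + int 1" "int i - int d - 1 = int i - int d - int 1"
    "2 * int i - int d - 1 = int i + int i - int d - int 1" by simp_all
  have p: "q powi int i = x" "q powi (- int i) = inverse x" "q powi (- int d) = inverse y"
    "q powi (int d - int i + 1) = y / x * q" "q powi (int i - int d - 1) = x / y / q"
    "q powi (2 * int i - int d - 1) = x * x / y / q"
    unfolding e using assms
    by (simp_all only: power_int_diff power_int_add power_int_minus power_int_of_nat x_def y_def simp_thms power_one_right)
  have p': "(q\<^sup>2) ^ i = x * x" "(q\<^sup>2) ^ Suc d = q * q * y * y"
    by (simp_all add: x_def y_def power2_eq_square power_mult_distrib)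
  show ?thesis
    unfolding split_factor_def p p' using nz assms by (simp add: field_simps power2_eq_square)
qed

text \<open>For \<open>\<tau> = 0\<close> and \<open>hs = 0\<close> the right side is the first
  split sequence; with \<open>h\<close> in place of \<open>\<mu>\<close> it is the second.\<close>

lemma krawtchouk_split_eq:
  fixes q :: "'a::field"
  assumes "q \<noteq> 0"
  shows "\<mu>s * q powi (- int d) * krawtchouk_split d (q\<^sup>2) (\<mu> * q powi (- int d)) i
    = - (\<mu> * \<mu>s * q powi (2 * int i - int d - 1) * split_factor d q i)"
proof -
  have "\<mu> * \<mu>s * q powi (2 * int i - int d - 1) * split_factor d q i
    = \<mu> * \<mu>s * (split_factor d q i * q powi (2 * int i - int d - 1))" by simp
  then show ?thesis
    unfolding split_factor_eq[OF assms] by (simp add: krawtchouk_split_def)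
qed

text \<open>Each of the two factors changes sign when \<open>q\<close> is inverted, so the product
  does not.\<close>

lemma split_factor_inverse: "q \<noteq> 0 \<Longrightarrow> split_factor d (inverse q) i = split_factor d q i"
  for q :: "'a::field"
proof -
  have "inverse q powi k = q powi (- k)" for k by (simp add: power_int_inverse power_int_minus)
  moreover have "- (int d - int i + 1) = int i - int d - 1" "- (int i - int d - 1) = int d - int i + 1" by simp_all
  ultimately show ?thesis by (simp only: split_factor_def minus_minus) (simp add: algebra_simps)
qed

text \<open>The two sides of the quadratic relation between consecutive differences differ by
  \<open>- u w (1 - r)^2 (1 - r^2)^2 / r^3\<close>, so for \<open>r^2 \<noteq> 1\<close> four terms
  suffice to detect \<open>u * w\<close>.\<close>

lemma geometric_differences:
  fixes u w r :: "'a::field"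
  assumes "r \<noteq> 0" "r\<^sup>2 \<noteq> 1" "\<And>i. i \<le> 3 \<Longrightarrow> t i = s + u * r ^ i + w / r ^ i"
    and "(t 0 - t 1) * (t 2 - t 3) = (t 1 - t 2) * (t 1 - t 2)"
  shows "u * w = 0"
proof -
  have "(t 0 - t 1) * (t 2 - t 3) - (t 1 - t 2) * (t 1 - t 2) = - (u * w * (1 - r)\<^sup>2 * (1 - r\<^sup>2)\<^sup>2) / r ^ 3"
    using assms(1) by (simp add: assms(3) field_simps power2_eq_square power3_eq_cube)
  then have "u * w * (1 - r)\<^sup>2 * (1 - r\<^sup>2)\<^sup>2 = 0" using assms(1,4) by simp
  moreover have "r \<noteq> 1" using assms(2) by auto
  ultimately show ?thesis using assms(2) by auto
qed

lemma q_power_four_neq_1: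
  fixes q :: "'a::field"
  assumes "q \<noteq> 0" "q powi 2 + q powi (-2) \<noteq> 2" "q powi 2 + q powi (-2) \<noteq> -2"
  shows "(q\<^sup>2)\<^sup>2 \<noteq> 1"
proof
  assume "(q\<^sup>2)\<^sup>2 = 1"
  then have "q\<^sup>2 = 1 \<or> q\<^sup>2 = -1" by (rule power2_eq_1_iff[THEN iffD1])
  then show False using assms(2,3) by (auto simp: power_int_minus)
qed

lemma parameter_array_cong:
  assumes "\<And>i. i \<le> d \<Longrightarrow> \<theta> i = \<theta>' i" "\<And>i. i \<le> d \<Longrightarrow> \<theta>s i = \<theta>s' i"
    and "\<And>i. i \<in> {1..d} \<Longrightarrow> \<phi>1 i = \<phi>1' i" "\<And>i. i \<in> {1..d} \<Longrightarrow> \<phi>2 i = \<phi>2' i"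
  shows "parameter_array s d A As \<theta> \<theta>s \<phi>1 \<phi>2 \<longleftrightarrow> parameter_array s d A As \<theta>' \<theta>s' \<phi>1' \<phi>2'"
proof -
  have "bij_betw \<theta> {..d} B \<longleftrightarrow> bij_betw \<theta>' {..d} B" "bij_betw \<theta>s {..d} B \<longleftrightarrow> bij_betw \<theta>s' {..d} B" for B
    using assms by (auto intro!: bij_betw_cong)
  moreover have "diagonal_with d \<theta> = diagonal_with d \<theta>'" "diagonal_with d \<theta>s = diagonal_with d \<theta>s'"
    "lower_bidiagonal d \<theta> = lower_bidiagonal d \<theta>'"
    "lower_bidiagonal d (\<lambda>i. \<theta> (d - i)) = lower_bidiagonal d (\<lambda>i. \<theta>' (d - i))"
    using assms by (auto simp: fun_eq_iff diagonal_with_def lower_bidiagonal_def)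
  moreover have "upper_bidiagonal d \<theta>s \<phi>1 = upper_bidiagonal d \<theta>s' \<phi>1'"
    "upper_bidiagonal d \<theta>s \<phi>2 = upper_bidiagonal d \<theta>s' \<phi>2'"
    using assms by (auto simp: fun_eq_iff upper_bidiagonal_def)
  ultimately show ?thesis by (simp add: parameter_array_def standard_ordering_def)
qed

text \<open>The paired exponents are opposite and \<open>split_factor\<close> is invariant, so
  inverting \<open>q\<close> merely swaps the two coefficients of each eigenvalue sequence. In this
  way the case \<open>\<mu>s = 0\<close> reduces to \<open>hs = 0\<close>.\<close>

lemma primary_q_data_inverse:
  assumes "q \<noteq> 0" "primary_q_data d q \<theta> \<theta>s \<phi>1 \<phi>2 \<delta> \<mu> h \<delta>s \<mu>s hs \<tau>"
  shows "primary_q_data d (inverse q) \<theta> \<theta>s \<phi>1 \<phi>2 \<delta> h \<mu> \<delta>s hs \<mu>s \<tau>"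
proof -
  have inv: "inverse q powi k = q powi (- k)" for k by (simp add: power_int_inverse power_int_minus)
  show ?thesis
    using assms(2) unfolding primary_q_data_def split_factor_inverse[OF assms(1)] inv
    by (simp add: algebra_simps)
qed

section \<open>The dual q-Krawtchouk data in the case \<open>hs = 0\<close>\<close>

context scalar_space
begin

lemma parameter_array_split_nonzero:
  assumes "parameter_array scale d A As \<theta> \<theta>s \<phi>1 \<phi>2" "i \<in> {1..d}"
  shows "\<phi>1 i \<noteq> 0" "\<phi>2 i \<noteq> 0"
proof -
  have A: "Vector_Spaces.linear scale scale A" and As: "Vector_Spaces.linear scale scale As"
    and inj: "inj_on \<theta> {..d}"
    using assms(1) by (auto simp: parameter_array_def leonard_pair_def standard_ordering_def bij_betw_def)
  obtain u where u: "indexed_basis scale d u" "has_matrix d u A (tri_matrix (\<lambda>_. 0) \<theta> (\<lambda>_. 0))"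
    "irreducible_tridiagonal d (matrix_of scale d u As)"
    using assms(1) diagonal_with_iff_has_matrix by (auto simp: parameter_array_def standard_ordering_def)
  obtain v where v: "indexed_basis scale d v" "has_matrix d v A (tri_matrix (\<lambda>_. 1) \<theta> (\<lambda>_. 0))"
    "has_matrix d v As (tri_matrix (\<lambda>_. 0) \<theta>s \<phi>1)"
    using assms(1) lower_bidiagonal_iff_has_matrix upper_bidiagonal_iff_has_matrix
    unfolding parameter_array_def by blast
  show "\<phi>1 i \<noteq> 0"
    by (rule split_sequence_nonzero[OF v(1) A v(2) As v(3) inj u assms(2)])
  obtain v' where v': "indexed_basis scale d v'" "has_matrix d v' A (tri_matrix (\<lambda>_. 1) (\<lambda>i. \<theta> (d - i)) (\<lambda>_. 0))"
    "has_matrix d v' As (tri_matrix (\<lambda>_. 0) \<theta>s \<phi>2)"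
    using assms(1) lower_bidiagonal_iff_has_matrix upper_bidiagonal_iff_has_matrix
    unfolding parameter_array_def by blast
  have inj': "inj_on (\<lambda>i. \<theta> (d - i)) {..d}"
    by (rule inj_onI) (use inj in \<open>auto dest!: inj_onD\<close>)
  \<comment> \<open>The second split form lists the eigenvalues of \<open>A\<close> backwards; the
    eigenbasis is reversed to match, which preserves irreducible tridiagonal shape.\<close>
  define ur where "ur i = u (d - i)" for i
  have ur: "indexed_basis scale d ur"
    unfolding ur_def by (rule indexed_basis_reverse[OF u(1)])
  have urA: "has_matrix d ur A (tri_matrix (\<lambda>_. 0) (\<lambda>i. \<theta> (d - i)) (\<lambda>_. 0))"
    using u(2) by (simp add: has_matrix_tri_matrix_diag_iff ur_def)
  have "irreducible_tridiagonal d (matrix_of scale d ur As)"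
    unfolding irreducible_tridiagonal_def
  proof (intro allI impI conjI)
    fix i j assume ij: "i \<le> d" "j \<le> d"
    have M: "matrix_of scale d ur As i j = matrix_of scale d u As (d - i) (d - j)"
      unfolding ur_def by (rule matrix_of_reverse)
    have "d - i \<le> d" "d - j \<le> d" by simp_all
    note t = u(3)[unfolded irreducible_tridiagonal_def, rule_format, OF this]
    show "Suc j < i \<or> Suc i < j \<Longrightarrow> matrix_of scale d ur As i j = 0"
      unfolding M using ij by (intro conjunct1[OF t, rule_format]) auto
    show "i = Suc j \<or> j = Suc i \<Longrightarrow> matrix_of scale d ur As i j \<noteq> 0"
      unfolding M using ij by (intro conjunct2[OF t, rule_format]) auto
  qed
  then show "\<phi>2 i \<noteq> 0"
    by (rule split_sequence_nonzero[OF v'(1) A v'(2) As v'(3) inj' ur urA _ assms(2)])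
qed

text \<open>The constant ratio of the split sequences forces \<open>\<tau> = 0\<close> and nonzero
  \<open>\<mu>\<close>, \<open>h\<close>; after that the data fit
  \<open>krawtchouk_bipartite_contraction\<close>.\<close>

lemma near_bipartite_dual_q_Krawtchouk:
  fixes q \<mu> h \<mu>s \<mu>' h' :: 'a
  assumes char: "(1::'a) \<noteq> -1" and d: "3 \<le> d"
    and ratio: "\<And>i. i \<in> {1..d} \<Longrightarrow> \<phi>1 i / \<phi>2 i = c"
    and q: "q \<noteq> 0"
    and PA: "parameter_array scale d A As \<theta> \<theta>s \<phi>1 \<phi>2"
    and data: "primary_q_data d q \<theta> \<theta>s \<phi>1 \<phi>2 \<delta> \<mu> h \<delta>s \<mu>s 0 \<tau>"
    and \<mu>': "\<mu>' + h' = 0" "\<mu>' * h' = \<mu> * h"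
    and \<theta>': "\<And>i. i \<le> d \<Longrightarrow>
           \<theta>' i = \<mu>' * q powi (2 * int i - int d) + h' * q powi (int d - 2 * int i)"
    and \<phi>': "\<And>i. i \<in> {1..d} \<Longrightarrow>
           \<phi>1' i = h' * \<mu>s * q powi (2 * int i - int d - 1) * split_factor d q i \<and>
           \<phi>2' i = \<mu>' * \<mu>s * q powi (2 * int i - int d - 1) * split_factor d q i"
  defines "A' \<equiv> A - flat_part scale A As"
  shows "(near_bipartite scale d A As \<longleftrightarrow> diagonalizable scale A') \<and>
    (diagonalizable scale A' \<longleftrightarrow> multiplicity_free scale A') \<and>
    (multiplicity_free scale A' \<longleftrightarrow> (\<forall>i\<in>{1..d-1}. q ^ (2 * i) \<noteq> -1)) \<and>
    (near_bipartite scale d A As \<longrightarrow> parameter_array scale d A' As \<theta>' \<theta>s \<phi>1' \<phi>2')"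
proof -
  define r a b m where "r = q\<^sup>2" and "a = \<mu> * q powi (- int d)" and "b = h * q ^ d"
    and "m = \<mu>s * q powi (- int d)"
  define a' b' where "a' = \<mu>' * q powi (- int d)" and "b' = h' * q ^ d"
  have r0: "r \<noteq> 0" using q by (simp add: r_def)
  have rd: "r ^ d = q ^ d * q ^ d" by (simp add: r_def power2_eq_square power_mult_distrib)
  have qd: "q powi (- int d) = inverse (q ^ d)" by (simp add: power_int_minus)
  have inj: "inj_on \<theta> {..d}" and injs: "inj_on \<theta>s {..d}" and L: "leonard_pair scale d A As"
    using PA by (auto simp: parameter_array_def standard_ordering_def bij_betw_def)
  have \<theta>: "\<theta> i = \<delta> + a * r ^ i + b / r ^ i" and \<theta>s: "\<theta>s i = \<delta>s + m * r ^ i" if "i \<le> d" for i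
    using data that by (simp_all add: primary_q_data_def powi_two_minus[OF q] powi_minus_two[OF q]
        a_def b_def m_def r_def)
  \<comment> \<open>Both nondegeneracy conditions, on \<open>m\<close> and on the powers of
    \<open>r\<close>, come from comparing a later dual eigenvalue with
    \<open>\<theta>s 0\<close>.\<close>
  have m: "m \<noteq> 0"
    using inj_onD[OF injs, of 0 1] d by (auto simp: \<theta>s)
  have r1: "r ^ k \<noteq> 1" if "k \<in> {1..d}" for k
    using inj_onD[OF injs, of 0 k] that by (auto simp: \<theta>s)
  let ?y = "\<lambda>i. q powi (2 * int i - int d - 1)" and ?sf = "split_factor d q"
  have \<phi>: "\<phi>1 i = ?sf i * (\<tau> - \<mu> * \<mu>s * ?y i)" "\<phi>2 i = ?sf i * (\<tau> - h * \<mu>s * ?y i)"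
    if "i \<in> {1..d}" for i
    using data that by (simp_all add: primary_q_data_def)
  note nz = parameter_array_split_nonzero[OF PA]
  \<comment> \<open>The split factor cancels since the split sequences do not vanish, leaving a
    relation affine in \<open>?y i\<close>.\<close>
  have lin: "\<tau> - \<mu> * \<mu>s * ?y i = c * (\<tau> - h * \<mu>s * ?y i)" if "i \<in> {1..d}" for i
  proof -
    have "\<phi>1 i = c * \<phi>2 i" using ratio[OF that] nz(2)[OF that] by (auto simp: divide_eq_eq)
    then show ?thesis using nz(1)[OF that] unfolding \<phi>[OF that] by auto
  qed
  have y: "?y 2 = r * ?y 1" "?y 1 \<noteq> 0"
    using q by (simp_all add: r_def power_int_diff power2_eq_square power3_eq_cube power_int_add)
  \<comment> \<open>The affine relation holds at the distinct points \<open>?y 1\<close> and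
    \<open>?y 2 = r * ?y 1\<close>, so its coefficients agree: first \<open>\<mu> = c * h\<close>,
    then \<open>\<tau> = c * \<tau>\<close>.\<close>
  have "(\<mu> - c * h) * \<mu>s * (r - 1) * ?y 1
    = (\<tau> - \<mu> * \<mu>s * ?y 1 - c * (\<tau> - h * \<mu>s * ?y 1)) - (\<tau> - \<mu> * \<mu>s * ?y 2 - c * (\<tau> - h * \<mu>s * ?y 2))"
    unfolding y by (simp add: algebra_simps)
  also have "\<dots> = 0" using lin[of 1] lin[of 2] d by simp
  finally have \<mu>: "\<mu> = c * h" using y(2) m r1[of 1] d by (auto simp: m_def)
  have "\<tau> = c * \<tau>" using lin[of 1] d unfolding \<mu> by (simp add: algebra_simps)
  \<comment> \<open>Otherwise \<open>\<mu> = h\<close>, and the eigenvalue sequence would be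
    symmetric under reversal.\<close>
  moreover have "c \<noteq> 1"
  proof
    assume "c = 1"
    then have "\<theta> 0 = \<theta> d" using \<mu> q by (simp add: \<theta> a_def b_def rd qd field_simps)
    then show False using inj_onD[OF inj, of 0 d] d by simp
  qed
  ultimately have \<tau>: "\<tau> = 0" by simp
  have "\<mu> \<noteq> 0" "h \<noteq> 0" using nz[of 1] \<phi>[of 1] d \<tau> by auto
  then have ab: "a \<noteq> 0" "b \<noteq> 0" using q by (simp_all add: a_def b_def)
  have split: "m * krawtchouk_split d r (x * q powi (- int d)) i = - (x * \<mu>s * ?y i * ?sf i)" for x i
    unfolding m_def r_def by (rule krawtchouk_split_eq[OF q])
  have \<phi>1: "\<phi>1 i = m * krawtchouk_split d r a i" if "i \<in> {1..d}" for i
    using \<phi>(1)[OF that] by (simp add: \<tau> a_def split)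
  obtain v where v: "indexed_basis scale d v" "has_matrix d v A (tri_matrix (\<lambda>_. 1) \<theta> (\<lambda>_. 0))"
    "has_matrix d v As (tri_matrix (\<lambda>_. 0) \<theta>s \<phi>1)"
    using PA lower_bidiagonal_iff_has_matrix upper_bidiagonal_iff_has_matrix
    unfolding parameter_array_def by blast
  have vA: "has_matrix d v A (tri_matrix (\<lambda>_. 1) (\<lambda>i. \<delta> + a * r ^ i + b / r ^ i) (\<lambda>_. 0))"
    using v(2) by (rule iffD1[OF has_matrix_cong, rotated]) (simp only: tri_matrix_def \<theta>)
  have vAs: "has_matrix d v As (tri_matrix (\<lambda>_. 0) (\<lambda>i. \<delta>s + m * r ^ i) (\<lambda>i. m * krawtchouk_split d r a i))"
    using v(3) by (rule iffD1[OF has_matrix_cong, rotated]) (auto simp: tri_matrix_def \<theta>s \<phi>1)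
  have injs': "inj_on (\<lambda>i. \<delta>s + m * r ^ i) {..d}"
    using injs by (rule iffD1[OF inj_on_cong, rotated]) (simp add: \<theta>s)
  have ab': "a' * b' = a * b" "a' * r ^ d + b' = 0"
    using q \<mu>' by (simp_all add: a'_def b'_def a_def b_def rd qd field_simps flip: distrib_right)
  have b'r: "b' / r ^ d = h' * q powi (- int d)"
    using q by (simp add: b'_def rd qd field_simps)
  \<comment> \<open>The minus sign in \<open>split\<close> is absorbed here; this is why
    \<open>h'\<close> stands in the first new split sequence and \<open>\<mu>'\<close> in the
    second.\<close>
  have h': "h' = - \<mu>'" using \<mu>'(1) by (simp add: eq_neg_iff_add_eq_0 add.commute)
  have "parameter_array scale d A' As \<theta>' \<theta>s \<phi>1' \<phi>2' \<longleftrightarrow>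
    parameter_array scale d A' As (\<lambda>i. a' * r ^ i + b' / r ^ i) (\<lambda>i. \<delta>s + m * r ^ i)
        (\<lambda>i. m * krawtchouk_split d r a' i) (\<lambda>i. m * krawtchouk_split d r (b' / r ^ d) i)"
  proof (rule parameter_array_cong)
    show "\<theta>' i = a' * r ^ i + b' / r ^ i" if "i \<le> d" for i
      using \<theta>'[OF that] by (simp add: powi_two_minus[OF q] powi_minus_two[OF q] a'_def b'_def r_def)
    show "\<phi>1' i = m * krawtchouk_split d r a' i" if "i \<in> {1..d}" for i
      using \<phi>'[OF that] by (simp add: a'_def split h')
    show "\<phi>2' i = m * krawtchouk_split d r (b' / r ^ d) i" if "i \<in> {1..d}" for i
      using \<phi>'[OF that] unfolding b'r split by (simp add: h')
  qed (simp add: \<theta>s)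
  then show ?thesis
    using krawtchouk_bipartite_contraction[OF r0 r1 ab m char L v(1) vA vAs injs' ab']
    by (simp add: A'_def r_def flip: power_mult)
qed

end

theorem proposition23p7:
  fixes scale :: "'a::alg_closed_field \<Rightarrow> 'v::ab_group_add \<Rightarrow> 'v"
    and d :: nat
    and A As F :: "'v \<Rightarrow> 'v"
    and \<theta> \<theta>s \<phi>1 \<phi>2 \<theta>' \<phi>1' \<phi>2' :: "nat \<Rightarrow> 'a"
    and \<beta> q \<delta> \<mu> h \<delta>s \<mu>s hs \<tau> \<mu>' h' :: 'a
  assumes "vector_space scale"
    and "CHAR('a) \<noteq> 2"
    and "3 \<le> d"
    and "leonard_pair scale d A As"
    and "dual_q_Krawtchouk_type scale d A As"
    and "F = flat_part scale A As"
    and "fundamental_constant scale d A As \<beta>"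
    and "q \<noteq> 0" and "\<beta> = q powi 2 + q powi (-2)"
    and "parameter_array scale d A As \<theta> \<theta>s \<phi>1 \<phi>2"
    and "primary_q_data d q \<theta> \<theta>s \<phi>1 \<phi>2 \<delta> \<mu> h \<delta>s \<mu>s hs \<tau>"
    and "\<mu>' + h' = 0" and "\<mu>' * h' = \<mu> * h"
    and "\<And>i. i \<le> d \<Longrightarrow>
           \<theta>' i = \<mu>' * q powi (2 * int i - int d) + h' * q powi (int d - 2 * int i)"
    and "\<And>i. \<mu>s = 0 \<Longrightarrow> i \<in> {1..d} \<Longrightarrow>
           \<phi>1' i = \<mu>' * hs * q powi (int d - 2 * int i + 1) * split_factor d q i \<and>
           \<phi>2' i = h' * hs * q powi (int d - 2 * int i + 1) * split_factor d q i"
    and "\<And>i. hs = 0 \<Longrightarrow> i \<in> {1..d} \<Longrightarrow>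
           \<phi>1' i = h' * \<mu>s * q powi (2 * int i - int d - 1) * split_factor d q i \<and>
           \<phi>2' i = \<mu>' * \<mu>s * q powi (2 * int i - int d - 1) * split_factor d q i"
  shows "(near_bipartite scale d A As \<longleftrightarrow> diagonalizable scale (A - F))
       \<and> (diagonalizable scale (A - F) \<longleftrightarrow> multiplicity_free scale (A - F))
       \<and> (multiplicity_free scale (A - F) \<longleftrightarrow> (\<forall>i\<in>{1..d-1}. q ^ (2 * i) \<noteq> -1))
       \<and> (near_bipartite scale d A As \<longrightarrow>
            parameter_array scale d (A - F) As \<theta>' \<theta>s \<phi>1' \<phi>2')"
proof -
  interpret vector_space scale by fact
  interpret scalar_space scale by unfold_locales
  note d = assms(3) and q = assms(8) and PA = assms(10) and data = assms(11)
  have char: "(1::'a) \<noteq> -1"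
  proof
    assume "(1::'a) = -1"
    then have "of_nat 2 = (0::'a)" by (simp add: eq_neg_iff_add_eq_0)
    then have "CHAR('a) dvd 2" by (simp only: of_nat_eq_0_iff_char_dvd)
    moreover have "CHAR('a) \<noteq> 1" by simp
    ultimately show False using assms(2) by (metis two_is_prime_nat prime_nat_iff)
  qed
  have so: "standard_ordering scale d A As \<theta>" "standard_ordering scale d As A \<theta>s"
    and injs: "inj_on \<theta>s {..d}"
    using PA by (auto simp: parameter_array_def standard_ordering_def bij_betw_def)
  \<comment> \<open>The ratio at \<open>i = 2\<close> shows that the relation
    \<open>fundamental_constant\<close> determines its scalar, so the witness in
    \<open>type_I\<close> is the given \<open>\<beta>\<close>.\<close>
  have beta: "(\<theta> 0 - \<theta> 3) / (\<theta> 1 - \<theta> 2) = \<beta>' + 1" if "fundamental_constant scale d A As \<beta>'" for \<beta>'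
    using that so d unfolding fundamental_constant_def by (force dest: bspec[of _ _ 2])
  have "\<beta> \<noteq> 2" "\<beta> \<noteq> -2"
    using assms(5) beta[OF assms(7)] beta unfolding dual_q_Krawtchouk_type_def type_I_def by auto
  then have q4: "(q\<^sup>2)\<^sup>2 \<noteq> 1" using q_power_four_neq_1[OF q] assms(9) by blast
  obtain c c' where c: "\<And>i. i \<in> {1..d-1} \<Longrightarrow> (\<theta>s (i - 1) - \<theta>s i) / (\<theta>s i - \<theta>s (i + 1)) = c"
    and c': "\<And>i. i \<in> {1..d} \<Longrightarrow> \<phi>1 i / \<phi>2 i = c'"
    using assms(5)[unfolded dual_q_Krawtchouk_type_def, THEN conjunct2, rule_format, OF PA] by blast
  \<comment> \<open>The two factors are the coefficients of \<open>r ^ i\<close> and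
    \<open>1 / r ^ i\<close> in \<open>\<theta>s i\<close> for \<open>r = q\<^sup>2\<close>. As
    \<open>d \<ge> 3\<close>, the dual eigenvalues 0 to 3 are available, and the constant ratio at
    \<open>i = 1\<close> and \<open>i = 2\<close> gives the quadratic relation.\<close>
  have "(\<mu>s * q powi (- int d)) * (hs * q ^ d) = 0"
  proof (rule geometric_differences)
    show "q\<^sup>2 \<noteq> 0" using q by simp
    show "(q\<^sup>2)\<^sup>2 \<noteq> 1" by (rule q4)
    show "\<theta>s i = \<delta>s + \<mu>s * q powi (- int d) * (q\<^sup>2) ^ i + hs * q ^ d / (q\<^sup>2) ^ i" if "i \<le> 3" for i
      using data that d by (simp add: primary_q_data_def powi_two_minus[OF q] powi_minus_two[OF q])
    have i: "1 \<in> {1..d-1}" "2 \<in> {1..d-1}" using d by auto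
    have "\<theta>s 1 \<noteq> \<theta>s 2" "\<theta>s 2 \<noteq> \<theta>s 3"
      using inj_onD[OF injs, of 1 2] inj_onD[OF injs, of 2 3] d by auto
    moreover have "(\<theta>s 0 - \<theta>s 1) / (\<theta>s 1 - \<theta>s 2) = (\<theta>s 1 - \<theta>s 2) / (\<theta>s 2 - \<theta>s 3)"
      using c[OF i(1)] c[OF i(2)] by (simp add: numeral_2_eq_2 numeral_3_eq_3)
    ultimately show "(\<theta>s 0 - \<theta>s 1) * (\<theta>s 2 - \<theta>s 3) = (\<theta>s 1 - \<theta>s 2) * (\<theta>s 1 - \<theta>s 2)"
      by (simp add: frac_eq_eq)
  qed
  then consider "hs = 0" | "\<mu>s = 0" using q by auto
  then show ?thesis
  proof cases
    case 1
    show ?thesis unfolding assms(6)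
      by (rule near_bipartite_dual_q_Krawtchouk[OF char d c' q PA data[unfolded 1] assms(12,13,14) assms(16)[OF 1]])
  next
    case 2
    \<comment> \<open>Inverting \<open>q\<close> leads back to the first case, with
      \<open>\<mu>\<close>, \<open>h\<close> and also \<open>\<mu>'\<close>, \<open>h'\<close>
      exchanged; the condition on powers of \<open>q\<close> is invariant.\<close>
    have inv: "inverse q powi k = q powi (- k)" for k by (simp add: power_int_inverse power_int_minus)
    have neg: "inverse q ^ (2 * i) = -1 \<longleftrightarrow> q ^ (2 * i) = -1" for i
      by (metis inverse_inverse_eq inverse_minus_eq inverse_1 power_inverse)
    have "(near_bipartite scale d A As \<longleftrightarrow> diagonalizable scale (A - flat_part scale A As))
       \<and> (diagonalizable scale (A - flat_part scale A As) \<longleftrightarrow> multiplicity_free scale (A - flat_part scale A As))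
       \<and> (multiplicity_free scale (A - flat_part scale A As) \<longleftrightarrow> (\<forall>i\<in>{1..d-1}. inverse q ^ (2 * i) \<noteq> -1))
       \<and> (near_bipartite scale d A As \<longrightarrow>
            parameter_array scale d (A - flat_part scale A As) As \<theta>' \<theta>s \<phi>1' \<phi>2')"
    proof (rule near_bipartite_dual_q_Krawtchouk[OF char d c' _ PA])
      show "primary_q_data d (inverse q) \<theta> \<theta>s \<phi>1 \<phi>2 \<delta> h \<mu> \<delta>s hs 0 \<tau>"
        using primary_q_data_inverse[OF q data] 2 by simp
      show "h' + \<mu>' = 0" "h' * \<mu>' = h * \<mu>" using assms(12,13) by (simp_all add: ac_simps)
      show "\<theta>' i = h' * inverse q powi (2 * int i - int d) + \<mu>' * inverse q powi (int d - 2 * int i)"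
        if "i \<le> d" for i
        using assms(14)[OF that] by (simp add: inv)
      show "\<phi>1' i = \<mu>' * hs * inverse q powi (2 * int i - int d - 1) * split_factor d (inverse q) i \<and>
          \<phi>2' i = h' * hs * inverse q powi (2 * int i - int d - 1) * split_factor d (inverse q) i"
        if "i \<in> {1..d}" for i
        using assms(15)[OF 2 that] by (simp add: inv split_factor_inverse[OF q] algebra_simps)
    qed (use q in simp_all)
    then show ?thesis unfolding assms(6) neg .
  qed
qed

end
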